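(* Let $B$ be a left or right coideal subalgebra of $S$. Then $S$ is a free left $B$-module (and, consequently, a free right $B$-module).
   Context: Let $\mathcal H$ be a finite-dimensional Hilbert space and $V$ a multiplicative unitary on $\mathcal H$ ($V_{12}V_{13}V_{23}=V_{23}V_{12}$) of multiplicity 1 (one-dimensional space of vectors $\xi$ with $V(\xi\otimes\eta)=\xi\otimes\eta$ for all $\eta$). $S=\{(\omega\otimes\mathrm{id})(V):\omega\in\mathcal L(\mathcal H)^*\}$ with coproduct $\delta(x)=V(x\otimes1)V^*$. A left (resp. right) coideal subalgebra of $S$ is a subalgebra $B\subset S$ containing $1$ with $\delta(B)\subset S\otimes B$ (resp. $\delta(B)\subset B\otimes S$). *)

theory Defs
  imports "HOL-Analysis.Analysis"
begin

text \<open>The Hilbert space H is modelled as complex^'n (standard inner product),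
  operators on H as complex^'n^'n, operators on H\<otimes>H as
  complex^('n\<times>'n)^('n\<times>'n), operators on H\<otimes>H\<otimes>H as
  complex^('n\<times>'n\<times>'n)^('n\<times>'n\<times>'n).\<close>

type_synonym ('n) op1 = "complex^('n::finite)^'n"
type_synonym ('n) op2 = "complex^('n::finite\<times>'n)^('n\<times>'n)"
type_synonym ('n) op3 = "complex^('n::finite\<times>'n\<times>'n)^('n\<times>'n\<times>'n)"

definition madj :: "complex^('m::finite)^'m \<Rightarrow> complex^'m^'m" where
  "madj A = (\<chi> i j. cnj (A$j$i))"

definition unitary :: "complex^('m::finite)^'m \<Rightarrow> bool" where
  "unitary A \<longleftrightarrow> A ** madj A = mat 1 \<and> madj A ** A = mat 1"

definition cscale :: "complex \<Rightarrow> complex^('m::finite)^('k::finite) \<Rightarrow> complex^'m^'k" where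
  "cscale c A = (\<chi> i j. c * A$i$j)"

definition tensor_op :: "('n::finite) op1 \<Rightarrow> ('n::finite) op1 \<Rightarrow> ('n::finite) op2" where
  "tensor_op A B = (\<chi> p q. A$(fst p)$(fst q) * B$(snd p)$(snd q))"

definition tensor_vec :: "complex^('n::finite) \<Rightarrow> complex^'n \<Rightarrow> complex^('n\<times>'n)" where
  "tensor_vec x y = (\<chi> p. x$(fst p) * y$(snd p))"

definition leg12 :: "('n::finite) op2 \<Rightarrow> ('n::finite) op3" where
  "leg12 V = (\<chi> p q. V$(fst p, fst (snd p))$(fst q, fst (snd q)) *
                      (if snd (snd p) = snd (snd q) then 1 else 0))"

definition leg13 :: "('n::finite) op2 \<Rightarrow> ('n::finite) op3" where
  "leg13 V = (\<chi> p q. V$(fst p, snd (snd p))$(fst q, snd (snd q)) *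
                      (if fst (snd p) = fst (snd q) then 1 else 0))"

definition leg23 :: "('n::finite) op2 \<Rightarrow> ('n::finite) op3" where
  "leg23 V = (\<chi> p q. (if fst p = fst q then 1 else 0) * V$(snd p)$(snd q))"

definition multiplicative_unitary :: "('n::finite) op2 \<Rightarrow> bool" where
  "multiplicative_unitary V \<longleftrightarrow> unitary V \<and>
     leg12 V ** leg13 V ** leg23 V = leg23 V ** leg12 V"

definition fixed_space :: "('n::finite) op2 \<Rightarrow> (complex^'n) set" where
  "fixed_space V = {\<xi>. \<forall>\<eta>. V *v tensor_vec \<xi> \<eta> = tensor_vec \<xi> \<eta>}"

definition multiplicity_one :: "('n::finite) op2 \<Rightarrow> bool" where
  "multiplicity_one V \<longleftrightarrow>
     (\<exists>\<xi>\<in>fixed_space V. \<xi> \<noteq> 0 \<and> (\<forall>\<zeta>\<in>fixed_space V. \<exists>c::complex. \<zeta> = c *s \<xi>))"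

text \<open>Slice map (omega \<otimes> id)(V), where every linear functional omega on L(H)
  is written as omega(A) = sum_{i,k} w_{ik} A_{ik}.\<close>
definition slice :: "complex^('n::finite)^'n \<Rightarrow> ('n::finite) op2 \<Rightarrow> ('n::finite) op1" where
  "slice w V = (\<chi> j l. \<Sum>i\<in>UNIV. \<Sum>k\<in>UNIV. w$i$k * V$(i,j)$(k,l))"

definition Salg :: "('n::finite) op2 \<Rightarrow> ('n::finite) op1 set" where
  "Salg V = {slice w V | w. True}"

definition coproduct :: "('n::finite) op2 \<Rightarrow> ('n::finite) op1 \<Rightarrow> ('n::finite) op2" where
  "coproduct V x = V ** tensor_op x (mat 1) ** madj V"

definition alg_tensor :: "('n::finite) op1 set \<Rightarrow> ('n::finite) op1 set \<Rightarrow> ('n::finite) op2 set" where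
  "alg_tensor X Y = {(\<Sum>t<m. tensor_op (f t) (g t)) | (m::nat) f g.
                        (\<forall>t<m. f t \<in> X \<and> g t \<in> Y)}"

definition unital_subalgebra :: "('n::finite) op1 set \<Rightarrow> ('n::finite) op1 set \<Rightarrow> bool" where
  "unital_subalgebra B S \<longleftrightarrow> B \<subseteq> S \<and> mat 1 \<in> B \<and>
     (\<forall>x\<in>B. \<forall>y\<in>B. x + y \<in> B \<and> x ** y \<in> B) \<and>
     (\<forall>c x. x \<in> B \<longrightarrow> cscale c x \<in> B)"

definition left_coideal_subalgebra :: "('n::finite) op2 \<Rightarrow> ('n::finite) op1 set \<Rightarrow> bool" where
  "left_coideal_subalgebra V B \<longleftrightarrow> unital_subalgebra B (Salg V) \<and>
     (\<forall>b\<in>B. coproduct V b \<in> alg_tensor (Salg V) B)"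

definition right_coideal_subalgebra :: "('n::finite) op2 \<Rightarrow> ('n::finite) op1 set \<Rightarrow> bool" where
  "right_coideal_subalgebra V B \<longleftrightarrow> unital_subalgebra B (Salg V) \<and>
     (\<forall>b\<in>B. coproduct V b \<in> alg_tensor B (Salg V))"

text \<open>M is a free left B-module: there is a B-basis s_0..s_{k-1} of M
  (finite w.l.o.g., since everything is finite-dimensional and 1 \<in> B).\<close>
definition free_left_module :: "('n::finite) op1 set \<Rightarrow> ('n::finite) op1 set \<Rightarrow> bool" where
  "free_left_module B M \<longleftrightarrow> (\<exists>(k::nat) s. (\<forall>t<k. s t \<in> M) \<and>
     (\<forall>x\<in>M. \<exists>b. (\<forall>t<k. b t \<in> B) \<and> x = (\<Sum>t<k. b t ** s t)) \<and>
     (\<forall>b. (\<forall>t<k. b t \<in> B) \<and> (\<Sum>t<k. b t ** s t) = 0 \<longrightarrow> (\<forall>t<k. b t = 0)))"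

definition free_right_module :: "('n::finite) op1 set \<Rightarrow> ('n::finite) op1 set \<Rightarrow> bool" where
  "free_right_module B M \<longleftrightarrow> (\<exists>(k::nat) s. (\<forall>t<k. s t \<in> M) \<and>
     (\<forall>x\<in>M. \<exists>b. (\<forall>t<k. b t \<in> B) \<and> x = (\<Sum>t<k. s t ** b t)) \<and>
     (\<forall>b. (\<forall>t<k. b t \<in> B) \<and> (\<Sum>t<k. s t ** b t) = 0 \<longrightarrow> (\<forall>t<k. b t = 0)))"

end

theory Submission
  imports Defs
begin

text \<open>The matrix \<open>u\<close> over \<open>S\<close> given by \<open>V\<close> is a unitary corepresentation spanning \<open>S\<close>, and the
  matrix \<open>T = (id \<otimes> trace)(V)\<close> satisfies \<open>T\<^sup>2 = n T\<close>; unitarity then forces its columns to be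
  fixed vectors, so that the trace of \<open>H\<close> is invariant for the coproduct on both sides. For a
  coideal subalgebra \<open>B\<close>, the bijection \<open>b \<otimes> \<eta> \<mapsto> \<delta>(b)(1 \<otimes> \<eta>)\<close> of \<open>B \<otimes> H\<close> together with
  this invariance identifies the character of the regular \<open>B\<close>-module with a multiple of the
  trace. Applied to \<open>B\<close> and to \<open>S\<close>, this shows that the \<open>B\<close>-modules \<open>S\<close> and \<open>B\<close> have
  proportional characters. The radical of the trace form on \<open>B\<close> is stable under the coaction and
  killed by the counit, hence zero, so \<open>B\<close> is semisimple and characters decide: as long as the
  ratio is at least 1 a free summand splits off, and the counit excludes a remainder of ratio
  strictly between 0 and 1. Right modules are reduced to left ones by taking adjoints.

  All traces, dimensions and characters are over the reals, so a complex line has dimension 2.\<close>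

section \<open>Traces on subspaces\<close>

text \<open>\<open>B\<close> is not assumed closed under adjoints, so positivity of the trace does
  not make it semisimple; this is why its radical is attacked through the coaction. Complete
  reducibility rests on the Casimir element of a nondegenerate trace form, which yields both
  equivariant projections and an integral. Proportional characters alone do not give freeness,
  because the ratio need not be an integer: over the n by n matrices the column vectors have 1/n of
  the regular character. A scalar-valued character of the algebra excludes this, since the
  one-dimensional module that it defines occurs just once in the regular module. No antipode is
  constructed; what it would supply comes from unitarity of \<open>V\<close> and finite dimension.
  Left and right coideals differ only in the leg along which the coproduct is cut, and
  \<open>hopf_blocks\<close> collects what the two cuts share.\<close>

definition onb :: "'a::euclidean_space set \<Rightarrow> 'a set" where
  "onb M = (SOME C. C \<subseteq> M \<and> finite C \<and> card C = dim M \<and>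
     (\<forall>x\<in>C. \<forall>y\<in>C. x \<bullet> y = (if x = y then 1 else 0)) \<and>
     (\<forall>x\<in>M. x = (\<Sum>c\<in>C. (x \<bullet> c) *\<^sub>R c)))"

lemma orthonormal_expansion:
  fixes C :: "'a::euclidean_space set"
  assumes "finite C" "\<And>x y. x \<in> C \<Longrightarrow> y \<in> C \<Longrightarrow> x \<bullet> y = (if x = y then 1 else 0)"
    and "x \<in> span C"
  shows "x = (\<Sum>c\<in>C. (x \<bullet> c) *\<^sub>R c)"
proof (rule span_induct[OF assms(3), where P = "\<lambda>x. x = (\<Sum>c\<in>C. (x \<bullet> c) *\<^sub>R c)"])
  fix x assume base: "x \<in> C"
  have "(\<Sum>c\<in>C. (x \<bullet> c) *\<^sub>R c) = (\<Sum>c\<in>C. if x = c then c else 0)"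
    using base assms(2) by (intro sum.cong) auto
  also have "\<dots> = x" using base assms(1) by simp
  finally show "x = (\<Sum>c\<in>C. (x \<bullet> c) *\<^sub>R c)" by simp
next
  show "subspace {x. x = (\<Sum>c\<in>C. (x \<bullet> c) *\<^sub>R c)}"
  proof (rule subspaceI, goal_cases)
    case 1 then show ?case by simp
  next
    case (2 x y) then show ?case
      by (simp add: inner_add_left scaleR_add_left sum.distrib)
  next
    case (3 r x)
    then have "r *\<^sub>R x = r *\<^sub>R (\<Sum>c\<in>C. (x \<bullet> c) *\<^sub>R c)" by simp
    also have "\<dots> = (\<Sum>c\<in>C. ((r *\<^sub>R x) \<bullet> c) *\<^sub>R c)" by (simp add: scaleR_sum_right)
    finally show ?case unfolding mem_Collect_eq .
  qed
qed

lemma onb_exists: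
  fixes M :: "'a::euclidean_space set"
  assumes "subspace M"
  shows "onb M \<subseteq> M \<and> finite (onb M) \<and> card (onb M) = dim M \<and>
     (\<forall>x\<in>onb M. \<forall>y\<in>onb M. x \<bullet> y = (if x = y then 1 else 0)) \<and>
     (\<forall>x\<in>M. x = (\<Sum>c\<in>onb M. (x \<bullet> c) *\<^sub>R c))"
proof -
  obtain C where C: "C \<subseteq> M" "pairwise orthogonal C" "\<And>x. x \<in> C \<Longrightarrow> norm x = 1"
     "independent C" "card C = dim M" "span C = M"
    using orthonormal_basis_subspace[OF assms] by metis
  have fin: "finite C" using C(4) independent_imp_finite by blast
  have on: "x \<bullet> y = (if x = y then 1 else 0)" if "x \<in> C" "y \<in> C" for x y
    using C(2,3) that by (auto simp: pairwise_def orthogonal_def norm_eq_1)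
  have "\<forall>x\<in>M. x = (\<Sum>c\<in>C. (x \<bullet> c) *\<^sub>R c)"
    using orthonormal_expansion[OF fin on] C(6) by blast
  then show ?thesis
    unfolding onb_def using C(1,5) fin on
    by (intro someI_ex[where P = "\<lambda>C. C \<subseteq> M \<and> finite C \<and> card C = dim M \<and>
     (\<forall>x\<in>C. \<forall>y\<in>C. x \<bullet> y = (if x = y then 1 else 0)) \<and>
     (\<forall>x\<in>M. x = (\<Sum>c\<in>C. (x \<bullet> c) *\<^sub>R c))"]) blast
qed

context
  fixes M :: "'a::euclidean_space set"
  assumes M: "subspace M"
begin

lemma onb_in: "c \<in> onb M \<Longrightarrow> c \<in> M"
  using onb_exists[OF M] by blast

lemma finite_onb: "finite (onb M)"
  using onb_exists[OF M] by blast

lemma card_onb: "card (onb M) = dim M"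
  using onb_exists[OF M] by blast

lemma onb_inner: "c \<in> onb M \<Longrightarrow> d \<in> onb M \<Longrightarrow> c \<bullet> d = (if c = d then 1 else 0)"
  using onb_exists[OF M] by blast

lemma onb_expansion: "x \<in> M \<Longrightarrow> (\<Sum>c\<in>onb M. (x \<bullet> c) *\<^sub>R c) = x"
  using onb_exists[OF M] by force

lemma onb_parseval:
  assumes "x \<in> M"
  shows "(\<Sum>c\<in>onb M. (x \<bullet> c) * (c \<bullet> y)) = x \<bullet> y"
proof -
  have "x \<bullet> y = (\<Sum>c\<in>onb M. (x \<bullet> c) *\<^sub>R c) \<bullet> y"
    using onb_expansion[OF assms] by simp
  then show ?thesis by (simp add: inner_sum_left)
qed

lemma ex_linear_projection:
  obtains p where "linear p" "\<And>x. p x \<in> M" "\<And>x. x \<in> M \<Longrightarrow> p x = x"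
proof
  let ?p = "\<lambda>x. \<Sum>c\<in>onb M. (x \<bullet> c) *\<^sub>R c"
  show "linear ?p"
    by (rule linearI) (simp_all add: inner_add_left scaleR_add_left sum.distrib scaleR_sum_right)
  show "?p x \<in> M" for x
    using M by (intro subspace_sum subspace_scale onb_in)
  show "x \<in> M \<Longrightarrow> ?p x = x" for x
    by (rule onb_expansion)
qed

end

definition trace_on :: "'a::euclidean_space set \<Rightarrow> ('a \<Rightarrow> 'a) \<Rightarrow> real" where
  "trace_on M f = (\<Sum>c\<in>onb M. f c \<bullet> c)"

lemma trace_on_cong:
  "subspace M \<Longrightarrow> (\<And>x. x \<in> M \<Longrightarrow> f x = g x) \<Longrightarrow> trace_on M f = trace_on M g"
  unfolding trace_on_def by (intro sum.cong) (auto dest: onb_in)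

lemma trace_on_id: "subspace M \<Longrightarrow> trace_on M (\<lambda>x. x) = dim M"
  unfolding trace_on_def by (simp add: onb_inner card_onb)

lemma trace_on_add: "trace_on M (\<lambda>x. f x + g x) = trace_on M f + trace_on M g"
  unfolding trace_on_def by (simp add: inner_add_left sum.distrib)

lemma trace_on_sum: "trace_on M (\<lambda>x. \<Sum>i\<in>I. f i x) = (\<Sum>i\<in>I. trace_on M (f i))"
  unfolding trace_on_def by (simp add: inner_sum_left sum.swap[of _ I])

text \<open>Both sides expand to the same double sum over the two orthonormal bases. Allowing
  different spaces on the two sides is what lets traces be moved to images, summands and isomorphic
  copies.\<close>

lemma trace_on_commute:
  fixes f :: "'a::euclidean_space \<Rightarrow> 'b::euclidean_space"
  assumes M: "subspace M" and N: "subspace N" and f: "linear f" and g: "linear g"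
    and fM: "\<And>x. x \<in> M \<Longrightarrow> f x \<in> N" and gN: "\<And>x. x \<in> N \<Longrightarrow> g x \<in> M"
  shows "trace_on M (\<lambda>x. g (f x)) = trace_on N (\<lambda>x. f (g x))"
proof -
  have 1: "g (f c) \<bullet> c = (\<Sum>d\<in>onb N. (g d \<bullet> c) * (f c \<bullet> d))" if "c \<in> onb M" for c
  proof -
    have "g (f c) = g (\<Sum>d\<in>onb N. (f c \<bullet> d) *\<^sub>R d)"
      using onb_expansion[OF N fM[OF onb_in[OF M that]]] by simp
    then show ?thesis
      by (simp add: linear_sum[OF g] linear_scale[OF g] inner_sum_left mult.commute)
  qed
  have 2: "f (g d) \<bullet> d = (\<Sum>c\<in>onb M. (g d \<bullet> c) * (f c \<bullet> d))" if "d \<in> onb N" for d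
  proof -
    have "f (g d) = f (\<Sum>c\<in>onb M. (g d \<bullet> c) *\<^sub>R c)"
      using onb_expansion[OF M gN[OF onb_in[OF N that]]] by simp
    then show ?thesis
      by (simp add: linear_sum[OF f] linear_scale[OF f] inner_sum_left)
  qed
  show ?thesis
    unfolding trace_on_def by (simp add: 1 2 cong: sum.cong) (rule sum.swap)
qed

lemma trace_on_idempotent:
  assumes M: "subspace M" and p: "linear p" and pM: "\<And>x. x \<in> M \<Longrightarrow> p x \<in> M"
    and pp: "\<And>x. x \<in> M \<Longrightarrow> p (p x) = p x"
  shows "trace_on M p = dim (p ` M)"
proof -
  have N: "subspace (p ` M)" by (rule linear_subspace_image[OF p M])
  have "trace_on M (\<lambda>x. id (p x)) = trace_on (p ` M) (\<lambda>x. p (id x))"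
    by (rule trace_on_commute[OF M N p linear_id]) (use pM in auto)
  also have "\<dots> = trace_on (p ` M) (\<lambda>x. x)"
    by (rule trace_on_cong[OF N]) (use pp in auto)
  finally show ?thesis using trace_on_id[OF N] by simp
qed

lemma trace_on_iso:
  fixes h :: "'a::euclidean_space \<Rightarrow> 'b::euclidean_space"
  assumes M: "subspace M" and h: "linear h" and inj: "inj_on h M" and im: "h ` M = N"
    and f: "linear f" and g: "linear g" and fM: "\<And>x. x \<in> M \<Longrightarrow> f x \<in> M"
    and hf: "\<And>x. x \<in> M \<Longrightarrow> h (f x) = g (h x)"
  shows "trace_on M f = trace_on N g"
proof -
  obtain k where k: "linear k" "\<And>x. x \<in> M \<Longrightarrow> k (h x) = x"
    using linear_exists_left_inverse_on[OF h M inj] by blast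
  have N: "subspace N" using linear_subspace_image[OF h M] im by simp
  have gN: "g y \<in> N" if "y \<in> N" for y
    using that im hf fM by (metis (no_types, lifting) imageE imageI)
  have lin: "linear (\<lambda>y. k (g y))"
    using linear_compose[OF g k(1)] by (simp add: o_def)
  have "trace_on M f = trace_on M (\<lambda>x. k (g (h x)))"
    by (rule trace_on_cong[OF M]) (use hf k(2) fM in metis)
  also have "\<dots> = trace_on N (\<lambda>y. h (k (g y)))"
    by (rule trace_on_commute[OF M N h lin]) (use gN k(2) im in force)+
  also have "\<dots> = trace_on N g"
    by (rule trace_on_cong[OF N]) (use gN k(2) im in force)
  finally show ?thesis .
qed

lemma trace_on_split:
  assumes M: "subspace M" and N: "subspace N" and p: "linear p" and f: "linear f"
    and NM: "N \<subseteq> M" and pM: "\<And>x. x \<in> M \<Longrightarrow> p x \<in> N" and pN: "\<And>x. x \<in> N \<Longrightarrow> p x = x"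
    and fM: "\<And>x. x \<in> M \<Longrightarrow> f x \<in> M" and fN: "\<And>x. x \<in> N \<Longrightarrow> f x \<in> N"
    and fK: "\<And>x. x \<in> M \<Longrightarrow> p x = 0 \<Longrightarrow> p (f x) = 0"
  shows "trace_on M f = trace_on N f + trace_on {x\<in>M. p x = 0} f"
proof -
  let ?K = "{x\<in>M. p x = 0}"
  have K: "subspace ?K"
    using M p by (auto simp: subspace_def linear_0 linear_add linear_scale)
  have q: "linear (\<lambda>x. x - p x)"
    using linear_compose_sub[OF linear_ident p] .
  have fp: "linear (\<lambda>x. f (p x))" using linear_compose[OF p f] by (simp add: o_def)
  have "trace_on M f = trace_on M (\<lambda>x. f (p x)) + trace_on M (\<lambda>x. f (x - p x))"
    unfolding trace_on_add[symmetric] by (simp add: linear_diff[OF f])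
  moreover have "trace_on M (\<lambda>x. f (p x)) = trace_on N f"
  proof -
    have "trace_on M (\<lambda>x. f (p x)) = trace_on N (\<lambda>x. p (f x))"
      by (rule trace_on_commute[OF M N p f]) (use pM fN NM in auto)
    also have "\<dots> = trace_on N f" by (rule trace_on_cong[OF N]) (use pN fN in auto)
    finally show ?thesis .
  qed
  moreover have "trace_on M (\<lambda>x. f (x - p x)) = trace_on ?K f"
  proof -
    have "trace_on M (\<lambda>x. f (x - p x)) = trace_on ?K (\<lambda>x. f x - p (f x))"
      by (rule trace_on_commute[OF M K q f])
        (use pM NM pN fM M in \<open>auto simp: linear_diff[OF p] intro!: subspace_diff\<close>)
    also have "\<dots> = trace_on ?K f" by (rule trace_on_cong[OF K]) (use fK in auto)
    finally show ?thesis .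
  qed
  ultimately show ?thesis by simp
qed

text \<open>Extending \<open>h\<close> by the identity along the kernel of a projection onto
  \<open>W\<close> gives a surjective endomorphism of the whole space, where surjectivity implies
  injectivity.\<close>

lemma inj_on_of_image_eq:
  fixes h :: "'a::euclidean_space \<Rightarrow> 'a"
  assumes W: "subspace W" and h: "linear h" and im: "h ` W = W"
  shows "inj_on h W"
proof -
  obtain p where p: "linear p" "\<And>x. p x \<in> W" "\<And>x. x \<in> W \<Longrightarrow> p x = x"
    using ex_linear_projection[OF W] by blast
  let ?g = "\<lambda>x. h (p x) + (x - p x)"
  have lin: "linear ?g"
    using linear_compose_add[OF linear_compose[OF p(1) h] linear_compose_sub[OF linear_ident p(1)]]
    by (simp add: o_def)
  have "surj ?g"
    unfolding surj_def
  proof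
    fix y
    have "p y \<in> h ` W" using p(2) im by simp
    then obtain w where w: "w \<in> W" "h w = p y" by auto
    have "p (w + (y - p y)) = w"
      using w p by (simp add: linear_add linear_diff)
    then have "y = ?g (w + (y - p y))" using w by simp
    then show "\<exists>x. y = ?g x" ..
  qed
  then have "inj ?g" using linear_surjective_imp_injective[OF lin] by blast
  then have "inj_on ?g W" by (rule inj_on_subset) auto
  moreover have "?g x = h x" if "x \<in> W" for x using p(3)[OF that] by simp
  ultimately show ?thesis by (simp add: inj_on_def)
qed

lemma image_eq_of_inj_on:
  fixes h :: "'a::euclidean_space \<Rightarrow> 'a"
  assumes W: "subspace W" and h: "linear h" and inj: "inj_on h W" and im: "h ` W \<subseteq> W"
  shows "h ` W = W"
proof (rule subspace_dim_equal[OF linear_subspace_image[OF h W] W im])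
  have "dim (h ` W) = dim W"
    using dim_image_eq[OF h] inj W by (simp add: span_eq_iff[THEN iffD2])
  then show "dim W \<le> dim (h ` W)" by simp
qed

section \<open>Modules over an algebra with nondegenerate trace form\<close>

lemma cscale_mult_left: "cscale c A ** B = cscale c (A ** B)"
  by (simp add: cscale_def matrix_matrix_mult_def vec_eq_iff sum_distrib_left mult.assoc)

lemma cscale_mult_right: "A ** cscale c B = cscale c (A ** B)"
  by (simp add: cscale_def matrix_matrix_mult_def vec_eq_iff sum_distrib_left mult.left_commute)

lemma cscale_nth [simp]: "cscale c A $ i $ j = c * A $ i $ j"
  by (simp add: cscale_def)

lemma cscale_one [simp]: "cscale 1 A = A"
  by (simp add: vec_eq_iff)

lemma cscale_zero [simp]: "cscale 0 A = 0" "cscale c 0 = 0"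
  by (simp_all add: vec_eq_iff)

lemma cscale_cscale [simp]: "cscale a (cscale b A) = cscale (a * b) A"
  by (simp add: vec_eq_iff)

lemma cscale_of_real: "cscale (of_real r) A = r *\<^sub>R A"
  by (simp add: vec_eq_iff) (simp add: scaleR_conv_of_real)

lemma cscale_add_left: "cscale (a + b) A = cscale a A + cscale b A"
  by (simp add: vec_eq_iff algebra_simps)

lemma cscale_add_right: "cscale a (A + B) = cscale a A + cscale a B"
  by (simp add: vec_eq_iff algebra_simps)

lemma cscale_sum: "cscale c (sum f I) = (\<Sum>i\<in>I. cscale c (f i))"
  by (simp add: vec_eq_iff sum_distrib_left)

lemma matrix_add_mult_distrib: "(A + B) ** (C :: complex^'l::finite^'m::finite) = A ** C + B ** C"
  by (simp add: matrix_matrix_mult_def vec_eq_iff distrib_right sum.distrib)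

lemma bilinear_matrix_mult: "bilinear ((**) :: complex^'m::finite^'k::finite \<Rightarrow> complex^'l::finite^'m \<Rightarrow> complex^'l^'k)"
  unfolding bilinear_def
  by (auto intro!: linearI simp: matrix_add_ldistrib matrix_add_mult_distrib cscale_mult_left
      cscale_mult_right simp flip: cscale_of_real)

lemma linear_mult_left: "linear (\<lambda>x :: complex^'l::finite^'m::finite. A ** x)"
  using bilinear_matrix_mult unfolding bilinear_def by blast

lemma linear_mult_right: "linear (\<lambda>x :: complex^'m::finite^'k::finite. x ** A)"
  using bilinear_matrix_mult unfolding bilinear_def by blast

lemmas mult_linear_simps =
  linear_add[OF linear_mult_left] linear_add[OF linear_mult_right]
  linear_diff[OF linear_mult_left] linear_diff[OF linear_mult_right]
  linear_0[OF linear_mult_left] linear_0[OF linear_mult_right]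
  linear_scale[OF linear_mult_left] linear_scale[OF linear_mult_right]
  linear_sum[OF linear_mult_left] linear_sum[OF linear_mult_right]

definition char_on :: "(complex^'n^'n::finite) set \<Rightarrow> complex^'n^'n \<Rightarrow> real" where
  "char_on M b = trace_on M (\<lambda>x. b ** x)"

lemma linear_char_on: "linear (char_on M)"
  unfolding trace_on_def char_on_def
  by (rule linearI) (simp_all add: mult_linear_simps inner_add_left sum.distrib sum_distrib_left)

locale nondegenerate_algebra =
  fixes B :: "(complex^'n^'n::finite) set"
  assumes subspace_B: "subspace B"
    and one_B: "mat 1 \<in> B"
    and mult_B: "\<And>x y. x \<in> B \<Longrightarrow> y \<in> B \<Longrightarrow> x ** y \<in> B"
    and nondegenerate: "\<And>a. a \<in> B \<Longrightarrow> (\<And>b. b \<in> B \<Longrightarrow> char_on B (a ** b) = 0) \<Longrightarrow> a = 0"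
begin

lemma char_B_commute:
  assumes "a \<in> B" "b \<in> B"
  shows "char_on B (a ** b) = char_on B (b ** a)"
  using trace_on_commute[OF subspace_B subspace_B linear_mult_left[of b] linear_mult_left[of a]]
    assms mult_B by (simp add: matrix_mul_assoc char_on_def)

lemma nondegenerate_right:
  assumes a: "a \<in> B" and z: "\<And>b. b \<in> B \<Longrightarrow> char_on B (b ** a) = 0"
  shows "a = 0"
  by (rule nondegenerate[OF a]) (simp only: char_B_commute[OF a] z)

lemma char_expansion:
  assumes "x \<in> B"
  shows "char_on B (x ** y) = (\<Sum>c\<in>onb B. (x \<bullet> c) * char_on B (c ** y))"
proof -
  have "x ** y = (\<Sum>c\<in>onb B. (x \<bullet> c) *\<^sub>R (c ** y))"
    by (subst onb_expansion[OF subspace_B assms, symmetric]) (simp add: mult_linear_simps)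
  then show ?thesis
    by (simp add: linear_sum[OF linear_char_on] linear_scale[OF linear_char_on])
qed

text \<open>Riesz representation: \<open>?G y\<close> represents the functional
  \<open>x \<mapsto> char_on B (x ** y)\<close> on \<open>B\<close>. Nondegeneracy makes
  \<open>?G\<close> injective on \<open>B\<close>, and a dimension count makes it onto.\<close>

lemma ex_dual:
  assumes z: "z \<in> B"
  shows "\<exists>y\<in>B. \<forall>x\<in>B. char_on B (x ** y) = x \<bullet> z"
proof -
  let ?G = "\<lambda>y. \<Sum>c\<in>onb B. char_on B (c ** y) *\<^sub>R c"
  have lin: "linear ?G"
    by (rule linearI)
      (simp_all add: mult_linear_simps linear_add[OF linear_char_on] linear_scale[OF linear_char_on]
        scaleR_add_left sum.distrib scaleR_sum_right)
  have GB: "?G y \<in> B" for y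
    by (intro subspace_sum subspace_scale subspace_B onb_in[OF subspace_B])
  have G_inner: "?G y \<bullet> c = char_on B (c ** y)" if "c \<in> onb B" for y c
    using that finite_onb[OF subspace_B]
    by (simp add: inner_sum_left onb_inner[OF subspace_B] if_distrib[of "\<lambda>t. _ * t"] cong: if_cong)
  have Gx: "x \<bullet> ?G y = char_on B (x ** y)" if "x \<in> B" for x y
  proof -
    have "x \<bullet> ?G y = (\<Sum>c\<in>onb B. (x \<bullet> c) * (c \<bullet> ?G y))"
      by (rule onb_parseval[OF subspace_B that, symmetric])
    also have "\<dots> = (\<Sum>c\<in>onb B. (x \<bullet> c) * char_on B (c ** y))"
      by (rule sum.cong[OF refl], subst (2) inner_commute, subst G_inner) simp_all
    also have "\<dots> = char_on B (x ** y)" by (rule char_expansion[OF that, symmetric])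
    finally show ?thesis .
  qed
  have "inj_on ?G B"
  proof (rule inj_onI)
    fix y y' assume y: "y \<in> B" "y' \<in> B" "?G y = ?G y'"
    have "?G (y - y') = 0" using y linear_diff[OF lin] by simp
    then have "char_on B (x ** (y - y')) = 0" if "x \<in> B" for x
      using Gx[OF that, of "y - y'"] by simp
    then have "y - y' = 0"
      by (rule nondegenerate_right[OF subspace_diff[OF subspace_B y(1,2)]])
    then show "y = y'" by simp
  qed
  then have "?G ` B = B"
    using GB by (intro image_eq_of_inj_on[OF subspace_B lin]) auto
  then have "z \<in> ?G ` B" using z by simp
  then obtain y where y: "y \<in> B" "z = ?G y" by (rule imageE)
  show ?thesis
    unfolding y(2) by (rule bexI[OF _ y(1)], rule ballI, rule Gx[symmetric])
qed

section \<open>Dual bases and the Casimir element of the trace form\<close>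

definition dual :: "complex^'n^'n \<Rightarrow> complex^'n^'n" where
  "dual z = (SOME y. y \<in> B \<and> (\<forall>x\<in>B. char_on B (x ** y) = x \<bullet> z))"

lemma dual:
  assumes "z \<in> B"
  shows "dual z \<in> B" "x \<in> B \<Longrightarrow> char_on B (x ** dual z) = x \<bullet> z"
proof -
  have "dual z \<in> B \<and> (\<forall>x\<in>B. char_on B (x ** dual z) = x \<bullet> z)"
    unfolding dual_def by (rule someI_ex) (use ex_dual[OF assms] in blast)
  then show "dual z \<in> B" "x \<in> B \<Longrightarrow> char_on B (x ** dual z) = x \<bullet> z" by auto
qed

lemma dual_onb: "c \<in> onb B \<Longrightarrow> dual c \<in> B"
  by (rule dual(1)[OF onb_in[OF subspace_B]])

lemma dual_expansion:
  assumes y: "y \<in> B"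
  shows "(\<Sum>c\<in>onb B. char_on B (c ** y) *\<^sub>R dual c) = y" (is "?z = y")
proof -
  have zB: "?z \<in> B" by (intro subspace_sum subspace_scale subspace_B dual_onb)
  have "char_on B (x ** (?z - y)) = 0" if x: "x \<in> B" for x
  proof -
    have "char_on B (x ** ?z) = (\<Sum>c\<in>onb B. char_on B (c ** y) * char_on B (x ** dual c))"
      by (simp add: mult_linear_simps linear_sum[OF linear_char_on] linear_scale[OF linear_char_on])
    also have "\<dots> = (\<Sum>c\<in>onb B. (x \<bullet> c) * char_on B (c ** y))"
      by (rule sum.cong) (simp_all add: dual onb_in[OF subspace_B] x)
    also have "\<dots> = char_on B (x ** y)" by (rule char_expansion[OF x, symmetric])
    finally show ?thesis by (simp add: mult_linear_simps linear_diff[OF linear_char_on])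
  qed
  then have "?z - y = 0"
    by (rule nondegenerate_right[OF subspace_diff[OF subspace_B zB y]])
  then show ?thesis by simp
qed

text \<open>The sum of \<open>c \<otimes> dual c\<close> commutes with \<open>b\<close> in the
  bimodule \<open>B \<otimes> B\<close>; an arbitrary bilinear \<open>F\<close> stands in for the
  tensor product. As the two families are dual for the trace form, moving \<open>b\<close> across
  amounts to the cyclicity of that form.\<close>

lemma casimir:
  assumes F: "bilinear F" and b: "b \<in> B"
  shows "(\<Sum>c\<in>onb B. F (b ** c) (dual c)) = (\<Sum>c\<in>onb B. F c (dual c ** b))"
proof -
  note lin = F[unfolded bilinear_def, THEN conjunct1, rule_format]
    F[unfolded bilinear_def, THEN conjunct2, rule_format]
  have "F (b ** c) (dual c) = (\<Sum>e\<in>onb B. char_on B ((b ** c) ** dual e) *\<^sub>R F e (dual c))"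
    if c: "c \<in> onb B" for c
  proof -
    have bc: "b ** c \<in> B" using b c onb_in[OF subspace_B] mult_B by auto
    have "F (b ** c) (dual c) = F (\<Sum>e\<in>onb B. ((b ** c) \<bullet> e) *\<^sub>R e) (dual c)"
      by (simp add: onb_expansion[OF subspace_B bc])
    also have "\<dots> = (\<Sum>e\<in>onb B. ((b ** c) \<bullet> e) *\<^sub>R F e (dual c))"
      by (simp add: linear_sum[OF lin(2)] linear_scale[OF lin(2)])
    finally show ?thesis
      by (simp add: dual(2)[OF onb_in[OF subspace_B] bc] cong: sum.cong)
  qed
  then have "(\<Sum>c\<in>onb B. F (b ** c) (dual c)) =
    (\<Sum>e\<in>onb B. \<Sum>c\<in>onb B. char_on B ((b ** c) ** dual e) *\<^sub>R F e (dual c))"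
    by (simp cong: sum.cong) (rule sum.swap)
  also have "\<dots> = (\<Sum>e\<in>onb B. F e (dual e ** b))"
  proof (rule sum.cong[OF refl])
    fix e assume e: "e \<in> onb B"
    have db: "dual e ** b \<in> B" using b e dual_onb mult_B by auto
    have "char_on B ((b ** c) ** dual e) = char_on B (c ** (dual e ** b))" if "c \<in> onb B" for c
      using char_B_commute[OF b, of "c ** dual e"] that e dual_onb onb_in[OF subspace_B] mult_B
      by (simp add: matrix_mul_assoc)
    then have "(\<Sum>c\<in>onb B. char_on B ((b ** c) ** dual e) *\<^sub>R F e (dual c)) =
      F e (\<Sum>c\<in>onb B. char_on B (c ** (dual e ** b)) *\<^sub>R dual c)"
      by (simp add: linear_sum[OF lin(1)] linear_scale[OF lin(1)])
    then show "(\<Sum>c\<in>onb B. char_on B ((b ** c) ** dual e) *\<^sub>R F e (dual c)) = F e (dual e ** b)"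
      by (simp add: dual_expansion[OF db])
  qed
  finally show ?thesis .
qed

text \<open>Here it matters that the form is the trace of the regular module: summing
  \<open>(b ** c) \<bullet> c\<close> over the basis gives back \<open>char_on B b\<close>, so both
  sides pair equally with every \<open>b\<close>.\<close>

lemma casimir_one: "(\<Sum>c\<in>onb B. c ** dual c) = mat 1" (is "?z = _")
proof -
  have zB: "?z \<in> B" by (intro subspace_sum subspace_B mult_B dual_onb onb_in[OF subspace_B])
  have "char_on B (b ** (?z - mat 1)) = 0" if b: "b \<in> B" for b
  proof -
    have "char_on B (b ** ?z) = (\<Sum>c\<in>onb B. char_on B ((b ** c) ** dual c))"
      by (simp add: mult_linear_simps linear_sum[OF linear_char_on] matrix_mul_assoc)
    also have "\<dots> = (\<Sum>c\<in>onb B. (b ** c) \<bullet> c)"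
      by (rule sum.cong) (simp_all add: dual onb_in[OF subspace_B] b mult_B)
    also have "\<dots> = char_on B b" by (simp add: char_on_def trace_on_def)
    finally show ?thesis by (simp add: mult_linear_simps linear_diff[OF linear_char_on])
  qed
  then have "?z - mat 1 = 0"
    by (rule nondegenerate_right[OF subspace_diff[OF subspace_B zB one_B]])
  then show ?thesis by simp
qed

section \<open>Submodules and equivariant projections\<close>

definition submodule :: "(complex^'n^'n) set \<Rightarrow> bool" where
  "submodule M \<longleftrightarrow> subspace M \<and> (\<forall>b\<in>B. \<forall>x\<in>M. b ** x \<in> M)"

lemma submodule_subspace: "submodule M \<Longrightarrow> subspace M"
  by (simp add: submodule_def)

lemma submodule_mult: "submodule M \<Longrightarrow> b \<in> B \<Longrightarrow> x \<in> M \<Longrightarrow> b ** x \<in> M"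
  by (simp add: submodule_def)

text \<open>A linear projection \<open>q\<close> is averaged with the Casimir element, in the role
  of the mean over a group: \<open>casimir\<close> makes the result equivariant and
  \<open>casimir_one\<close> makes it the identity on \<open>N\<close>.\<close>

lemma maschke:
  assumes N: "submodule N"
  obtains p where "linear p" "\<And>x. p x \<in> N" "\<And>x. x \<in> N \<Longrightarrow> p x = x"
    "\<And>b x. b \<in> B \<Longrightarrow> p (b ** x) = b ** p x"
proof -
  obtain q where q: "linear q" "\<And>x. q x \<in> N" "\<And>x. x \<in> N \<Longrightarrow> q x = x"
    using ex_linear_projection[OF submodule_subspace[OF N]] by blast
  let ?p = "\<lambda>x. \<Sum>c\<in>onb B. c ** q (dual c ** x)"
  show thesis
  proof
    show "linear ?p"
      by (rule linearI) (simp_all add: mult_linear_simps linear_add[OF q(1)] linear_scale[OF q(1)]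
          sum.distrib scaleR_sum_right)
    show "?p x \<in> N" for x
      by (intro subspace_sum submodule_subspace[OF N] submodule_mult[OF N] q onb_in[OF subspace_B])
    show "?p x = x" if x: "x \<in> N" for x
    proof -
      have "?p x = (\<Sum>c\<in>onb B. c ** dual c) ** x"
        using q(3) submodule_mult[OF N] x dual_onb
        by (simp add: mult_linear_simps matrix_mul_assoc)
      then show ?thesis by (simp add: casimir_one)
    qed
    show "?p (b ** x) = b ** ?p x" if b: "b \<in> B" for b x
    proof -
      have "bilinear (\<lambda>y z. y ** q (z ** x))"
        unfolding bilinear_def
        by (auto intro!: linearI simp: mult_linear_simps linear_add[OF q(1)] linear_scale[OF q(1)])
      from casimir[OF this b] show ?thesis
        by (simp add: mult_linear_simps matrix_mul_assoc)
    qed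
  qed
qed

end

section \<open>Splitting free summands off a module\<close>

context nondegenerate_algebra
begin

lemma left_ideal_idempotent:
  assumes X: "submodule X" and XB: "X \<subseteq> B"
  obtains e where "e \<in> X" "\<And>x. x \<in> X \<Longrightarrow> x ** e = x"
proof -
  obtain p where p: "linear p" "\<And>x. p x \<in> X" "\<And>x. x \<in> X \<Longrightarrow> p x = x"
    "\<And>b x. b \<in> B \<Longrightarrow> p (b ** x) = b ** p x"
    using maschke[OF X] by blast
  show thesis
  proof
    show "p (mat 1) \<in> X" by (rule p)
    show "x ** p (mat 1) = x" if "x \<in> X" for x
      using p(4)[of x "mat 1"] p(3)[OF that] that XB by auto
  qed
qed

lemma submodule_B: "submodule B"
  by (simp add: submodule_def subspace_B mult_B)

lemma submodule_annihilator: "submodule {b \<in> B. b ** m = 0}"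
proof -
  have "subspace {b \<in> B. b ** m = 0}"
    using subspace_B by (auto simp: subspace_def mult_linear_simps matrix_add_mult_distrib)
  then show ?thesis by (auto simp: submodule_def mult_B mult_linear_simps simp flip: matrix_mul_assoc)
qed

lemma submodule_cyclic: "submodule ((\<lambda>b. b ** m) ` B)"
proof -
  have "subspace ((\<lambda>b. b ** m) ` B)"
    by (rule linear_subspace_image[OF linear_mult_right subspace_B])
  then show ?thesis by (auto simp: submodule_def mult_B matrix_mul_assoc)
qed

lemma submodule_kernel:
  assumes M: "submodule M" and p: "linear p" "\<And>b x. b \<in> B \<Longrightarrow> p (b ** x) = b ** p x"
  shows "submodule {x \<in> M. p x = 0}"
  using M p by (auto simp: submodule_def subspace_def linear_0 linear_add linear_scale mult_linear_simps)

lemma char_on_image: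
  assumes K: "submodule K" and inj: "inj_on (\<lambda>x. x ** m) K" and b: "b \<in> B"
  shows "char_on ((\<lambda>x. x ** m) ` K) b = char_on K b"
  unfolding char_on_def
  by (rule trace_on_iso[OF submodule_subspace[OF K] linear_mult_right inj refl linear_mult_left
        linear_mult_left, symmetric])
    (simp_all add: submodule_mult[OF K b] matrix_mul_assoc)

lemma char_on_split:
  assumes M: "submodule M" and N: "submodule N" and NM: "N \<subseteq> M"
    and p: "linear p" "\<And>x. x \<in> M \<Longrightarrow> p x \<in> N" "\<And>x. x \<in> N \<Longrightarrow> p x = x"
    "\<And>b x. b \<in> B \<Longrightarrow> p (b ** x) = b ** p x" and b: "b \<in> B"
  shows "char_on M b = char_on N b + char_on {x \<in> M. p x = 0} b"
  unfolding char_on_def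
  by (rule trace_on_split[OF submodule_subspace[OF M] submodule_subspace[OF N] p(1)
        linear_mult_left NM p(2,3)])
    (use b in \<open>auto simp: p(4) mult_linear_simps intro: submodule_mult[OF M] submodule_mult[OF N]\<close>)

lemma char_on_idempotent:
  assumes M: "submodule M" and e: "e \<in> B" "e ** e = e"
  shows "char_on M e = dim ((\<lambda>x. e ** x) ` M)"
  unfolding char_on_def
  by (rule trace_on_idempotent[OF submodule_subspace[OF M] linear_mult_left])
    (use e in \<open>auto simp: submodule_mult[OF M] matrix_mul_assoc\<close>)

text \<open>The annihilator of a suitable element is taken minimal. If it were nonzero, its idempotent
  generator would kill a complement of the cyclic submodule, against the trace count.\<close>

lemma ex_faithful_element:
  assumes M: "submodule M" and ch: "\<And>b. b \<in> B \<Longrightarrow> char_on M b = r * char_on B b" and r: "r \<ge> 1"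
  obtains m where "m \<in> M" "\<And>b. b \<in> B \<Longrightarrow> b ** m = 0 \<Longrightarrow> b = 0"
proof -
  let ?A = "\<lambda>m. {b \<in> B. b ** m = 0}"
  have "\<exists>m. m \<in> M \<and> (\<forall>m'. m' \<in> M \<longrightarrow> dim (?A m) \<le> dim (?A m'))"
    by (rule ex_has_least_nat[of "\<lambda>m. m \<in> M" 0]) (rule subspace_0[OF submodule_subspace[OF M]])
  then obtain m where m: "m \<in> M" and min: "\<And>m'. m' \<in> M \<Longrightarrow> dim (?A m) \<le> dim (?A m')"
    by blast
  define X where "X = ?A m"
  have X: "submodule X" unfolding X_def by (rule submodule_annihilator)
  have XB: "X \<subseteq> B" by (auto simp: X_def)
  obtain e where e: "e \<in> X" "\<And>x. x \<in> X \<Longrightarrow> x ** e = x"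
    using left_ideal_idempotent[OF X XB] by blast
  have eB: "e \<in> B" and ee: "e ** e = e" using e XB by auto
  define N where "N = (\<lambda>b. b ** m) ` B"
  have N: "submodule N" unfolding N_def by (rule submodule_cyclic)
  have NM: "N \<subseteq> M" using m submodule_mult[OF M] by (auto simp: N_def)
  obtain p where p: "linear p" "\<And>x. p x \<in> N" "\<And>x. x \<in> N \<Longrightarrow> p x = x"
    "\<And>b x. b \<in> B \<Longrightarrow> p (b ** x) = b ** p x"
    using maschke[OF N] by blast
  define K where "K = {x \<in> M. p x = 0}"
  have K: "submodule K" unfolding K_def by (rule submodule_kernel[OF M p(1,4)])
  \<comment> \<open>\<open>m\<close> is perturbed by \<open>e ** k\<close>. Since \<open>p\<close>
    separates the components in \<open>N\<close> and \<open>K\<close>, the annihilator can only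
    shrink; by minimality it is still \<open>X\<close>, so it contains \<open>e\<close>, which must
    then kill \<open>e ** k\<close>.\<close>
  have kill: "e ** k = 0" if k: "k \<in> K" for k
  proof -
    define m' where "m' = m + e ** k"
    have "m' \<in> M"
      using m k submodule_mult[OF M eB] subspace_add[OF submodule_subspace[OF M]]
      by (auto simp: m'_def K_def)
    have sub: "b ** m = 0 \<and> b ** e ** k = 0" if b: "b \<in> B" "b ** m' = 0" for b
    proof -
      have 1: "b ** m + b ** e ** k = 0"
        using b by (simp add: m'_def mult_linear_simps matrix_mul_assoc)
      have "p (b ** e ** k) = 0"
        using p(4)[OF mult_B[OF b(1) eB], of k] k by (simp add: K_def mult_linear_simps)
      moreover have "p (b ** m) = b ** m" using b by (intro p(3)) (auto simp: N_def)
      moreover have "p (b ** m + b ** e ** k) = 0" using 1 linear_0[OF p(1)] by simp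
      ultimately have "b ** m = 0" by (simp add: linear_add[OF p(1)])
      with 1 show ?thesis by simp
    qed
    then have "?A m' \<subseteq> X" by (auto simp: X_def)
    moreover have "dim X \<le> dim (?A m')" using min[OF \<open>m' \<in> M\<close>] by (simp add: X_def)
    ultimately have "?A m' = X"
      by (intro subspace_dim_equal submodule_subspace submodule_annihilator X)
    then have "e ** m' = 0" using e(1) by auto
    then have "e ** e ** k = 0" using sub[OF eB] by blast
    then show ?thesis by (simp add: ee)
  qed
  have "char_on K e = 0"
    using trace_on_cong[OF submodule_subspace[OF K], of "\<lambda>x. e ** x" "\<lambda>_. 0"] kill
    by (simp add: char_on_def trace_on_def[of _ "\<lambda>_. 0"])
  then have chM: "char_on M e = char_on N e"
    using char_on_split[OF M N NM p(1,2,3,4) eB] by (simp add: K_def)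
  \<comment> \<open>\<open>Y\<close> is a complement of \<open>X\<close> in \<open>B\<close>. As
    \<open>X\<close> is the annihilator of \<open>m\<close>, right multiplication by
    \<open>m\<close> maps \<open>Y\<close> isomorphically onto \<open>N\<close>.\<close>
  define Y where "Y = {x \<in> B. x ** e = 0}"
  have Y: "submodule Y" unfolding Y_def by (rule submodule_annihilator)
  have xe: "x ** e \<in> X" if "x \<in> B" for x using submodule_mult[OF X that e(1)] .
  have chB: "char_on B e = char_on X e + char_on Y e"
    unfolding Y_def using e(2) eB
    by (intro char_on_split[OF submodule_B X XB linear_mult_right xe]) (auto simp: matrix_mul_assoc)
  have "inj_on (\<lambda>x. x ** m) Y"
  proof (rule inj_onI)
    fix x y assume xy: "x \<in> Y" "y \<in> Y" "x ** m = y ** m"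
    then have "x - y \<in> X" "x - y \<in> Y"
      using subspace_diff[OF subspace_B] subspace_diff[OF submodule_subspace[OF Y]]
      by (auto simp: X_def Y_def mult_linear_simps)
    then have "x - y = 0" using e(2)[of "x - y"] by (simp add: Y_def)
    then show "x = y" by simp
  qed
  moreover have "(\<lambda>x. x ** m) ` Y = N"
  proof
    show "(\<lambda>x. x ** m) ` Y \<subseteq> N" by (auto simp: Y_def N_def)
    show "N \<subseteq> (\<lambda>x. x ** m) ` Y"
    proof
      fix y assume "y \<in> N"
      then obtain b where b: "b \<in> B" "y = b ** m" by (auto simp: N_def)
      have "(b ** e) ** m = 0" using xe[OF b(1)] by (simp add: X_def)
      then have "y = (b - b ** e) ** m" using b by (simp add: mult_linear_simps)
      moreover have "b - b ** e \<in> Y"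
        using b eB mult_B subspace_diff[OF subspace_B]
        by (simp add: Y_def mult_linear_simps ee flip: matrix_mul_assoc)
      ultimately show "y \<in> (\<lambda>x. x ** m) ` Y" by blast
    qed
  qed
  ultimately have "char_on N e = char_on Y e" using char_on_image[OF Y _ eB] by metis
  \<comment> \<open>The character of an idempotent is a dimension, so for \<open>r \<ge> 1\<close>
    both summands are nonnegative and must vanish.\<close>
  with chM chB ch[OF eB] have "(r - 1) * char_on B e + char_on X e = 0" by (simp add: algebra_simps)
  moreover have "char_on B e \<ge> 0" using char_on_idempotent[OF submodule_B eB ee] by simp
  moreover have "char_on X e \<ge> 0" using char_on_idempotent[OF X eB ee] by simp
  ultimately have "char_on X e = 0" using r by (smt (verit) mult_nonneg_nonneg)
  then have "dim ((\<lambda>x. e ** x) ` X) = 0" using char_on_idempotent[OF X eB ee] by simp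
  then have "(\<lambda>x. e ** x) ` X \<subseteq> {0}" by (simp add: dim_eq_0)
  then have "e ** e = 0" using e(1) by blast
  then have "e = 0" by (simp add: ee)
  then have "X \<subseteq> {0}" using e(2) by (force simp: mult_linear_simps)
  then show thesis using that[OF m] by (auto simp: X_def)
qed

text \<open>\<open>m\<close> becomes the last basis element, at index \<open>k\<close>. In a
  relation, \<open>p\<close> kills the terms before it and fixes the last one, which isolates the
  coefficient of \<open>m\<close>.\<close>

lemma free_left_module_Suc:
  assumes M: "submodule M" and m: "m \<in> M" and faithful: "\<And>b. b \<in> B \<Longrightarrow> b ** m = 0 \<Longrightarrow> b = 0"
    and p: "linear p" "\<And>x. p x \<in> (\<lambda>b. b ** m) ` B" "\<And>b. b \<in> B \<Longrightarrow> p (b ** m) = b ** m"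
    "\<And>b x. b \<in> B \<Longrightarrow> p (b ** x) = b ** p x"
    and free: "free_left_module B {x \<in> M. p x = 0}"
  shows "free_left_module B M"
proof -
  let ?K = "{x \<in> M. p x = 0}"
  obtain k s where s: "\<forall>t<k. s t \<in> ?K"
    "\<forall>x\<in>?K. \<exists>b. (\<forall>t<k. b t \<in> B) \<and> x = (\<Sum>t<(k::nat). b t ** s t)"
    "\<forall>b. (\<forall>t<k. b t \<in> B) \<and> (\<Sum>t<k. b t ** s t) = 0 \<longrightarrow> (\<forall>t<k. b t = 0)"
    using free unfolding free_left_module_def by blast
  let ?s = "s(k := m)"
  have sum_eq: "(\<Sum>t<Suc k. b t ** ?s t) = (\<Sum>t<k. b t ** s t) + b k ** m" for b
    by simp
  show ?thesis
    unfolding free_left_module_def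
  proof (rule exI[of _ "Suc k"], rule exI[of _ ?s], intro conjI ballI allI impI)
    show "?s t \<in> M" if "t < Suc k" for t using that m s(1) by auto
  next
    fix x assume x: "x \<in> M"
    obtain c where c: "c \<in> B" "p x = c ** m" using p(2)[of x] by auto
    have "x - p x \<in> ?K"
      using x c m submodule_mult[OF M] subspace_diff[OF submodule_subspace[OF M]] p(3)
      by (simp add: linear_diff[OF p(1)])
    then obtain b where b: "\<forall>t<k. b t \<in> B" "x - p x = (\<Sum>t<k. b t ** s t)" using s(2) by blast
    let ?b = "b(k := c)"
    have "(\<Sum>t<Suc k. ?b t ** ?s t) = (x - p x) + p x"
      unfolding sum_eq by (simp add: b(2)[symmetric] c(2))
    then have "x = (\<Sum>t<Suc k. ?b t ** ?s t)" by simp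
    moreover have "\<forall>t<Suc k. ?b t \<in> B" using b(1) c(1) by auto
    ultimately show "\<exists>b. (\<forall>t<Suc k. b t \<in> B) \<and> x = (\<Sum>t<Suc k. b t ** ?s t)" by blast
  next
    fix b t assume b: "(\<forall>t<Suc k. b t \<in> B) \<and> (\<Sum>t<Suc k. b t ** ?s t) = 0" and t: "t < Suc k"
    have z: "(\<Sum>t<k. b t ** s t) + b k ** m = 0" using b unfolding sum_eq by simp
    have "p (\<Sum>t<k. b t ** s t) = (\<Sum>t<k. b t ** p (s t))"
      using b by (simp add: linear_sum[OF p(1)] p(4))
    also have "\<dots> = 0" using s(1) by (simp add: mult_linear_simps)
    finally have "p (\<Sum>t<k. b t ** s t) = 0" .
    moreover have "p (b k ** m) = b k ** m" using p(3) b by blast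
    moreover have "p ((\<Sum>t<k. b t ** s t) + b k ** m) = 0" unfolding z by (rule linear_0[OF p(1)])
    ultimately have bm: "b k ** m = 0" by (simp add: linear_add[OF p(1)])
    then have "b k = 0" using faithful b by blast
    moreover have "\<forall>t<k. b t = 0" using s(3) z bm b by (auto simp: less_Suc_eq)
    ultimately show "b t = 0" using t by (auto simp: less_Suc_eq)
  qed
qed

text \<open>Each faithful element splits off a copy of \<open>B\<close>, which lowers the dimension
  and takes 1 from the ratio \<open>r\<close>. That a module of ratio below 1 vanishes requires the
  counit, so it enters here as the assumption \<open>small\<close>.\<close>

lemma free_of_char:
  assumes small: "\<And>M r. submodule M \<Longrightarrow> (\<And>b. b \<in> B \<Longrightarrow> char_on M b = r * char_on B b) \<Longrightarrow> r < 1 \<Longrightarrow> M = {0}"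
    and M: "submodule M" and ch: "\<And>b. b \<in> B \<Longrightarrow> char_on M b = r * char_on B b"
  shows "free_left_module B M"
  using M ch
proof (induction "dim M" arbitrary: M r rule: less_induct)
  case less
  show ?case
  proof (cases "r < 1")
    case True
    then have "M = {0}" using small less.prems by blast
    then show ?thesis unfolding free_left_module_def by (intro exI[of _ 0]) auto
  next
    case False
    obtain m where m: "m \<in> M" "\<And>b. b \<in> B \<Longrightarrow> b ** m = 0 \<Longrightarrow> b = 0"
      using ex_faithful_element[OF less.prems] False by (metis linorder_not_less)
    let ?N = "(\<lambda>b. b ** m) ` B"
    have N: "submodule ?N" by (rule submodule_cyclic)
    have NM: "?N \<subseteq> M" using m submodule_mult[OF less.prems(1)] by auto
    have inj: "inj_on (\<lambda>b. b ** m) B"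
    proof (rule inj_onI)
      fix x y assume "x \<in> B" "y \<in> B" "x ** m = y ** m"
      then have "x - y = 0" using m(2)[of "x - y"] subspace_diff[OF subspace_B]
        by (simp add: mult_linear_simps)
      then show "x = y" by simp
    qed
    obtain p where p: "linear p" "\<And>x. p x \<in> ?N" "\<And>x. x \<in> ?N \<Longrightarrow> p x = x"
      "\<And>b x. b \<in> B \<Longrightarrow> p (b ** x) = b ** p x"
      using maschke[OF N] by blast
    let ?K = "{x \<in> M. p x = 0}"
    have K: "submodule ?K" by (rule submodule_kernel[OF less.prems(1) p(1,4)])
    have "char_on ?K b = (r - 1) * char_on B b" if "b \<in> B" for b
      using char_on_split[OF less.prems(1) N NM p(1,2,3,4) that] less.prems(2)[OF that]
        char_on_image[OF submodule_B inj that] by (simp add: algebra_simps)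
    moreover have "dim ?K < dim M"
    proof (rule ccontr)
      assume "\<not> dim ?K < dim M"
      then have "?K = M"
        by (intro subspace_dim_equal submodule_subspace K less.prems(1)) auto
      then have "p m = 0" using m(1) by blast
      moreover have "p m = m" using p(3)[of "mat 1 ** m"] one_B by (metis imageI matrix_mul_lid)
      ultimately have "mat 1 ** m = 0" by simp
      then have "mat 1 = (0 :: complex^'n^'n)" using m(2)[OF one_B] by blast
      then have "(mat 1 :: complex^'n^'n) $ i $ i = 0" for i by simp
      then show False by (simp add: mat_def)
    qed
    ultimately have "free_left_module B ?K" using less.hyps K by blast
    then show ?thesis
      using free_left_module_Suc[OF less.prems(1) m p(1,2) _ p(4)] p(3) by blast
  qed
qed

end

section \<open>The counit and its integral\<close>

locale augmented_algebra = nondegenerate_algebra B for B :: "(complex^'n^'n::finite) set" +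
  fixes \<epsilon> :: "complex^'n^'n::finite \<Rightarrow> complex"
  assumes cscale_B: "\<And>c x. x \<in> B \<Longrightarrow> cscale c x \<in> B"
    and eps_add: "\<And>x y. \<epsilon> (x + y) = \<epsilon> x + \<epsilon> y"
    and eps_cscale: "\<And>c x. \<epsilon> (cscale c x) = c * \<epsilon> x"
    and eps_one: "\<epsilon> (mat 1) = 1"
    and eps_mult: "\<And>x y. x \<in> B \<Longrightarrow> y \<in> B \<Longrightarrow> \<epsilon> (x ** y) = \<epsilon> x * \<epsilon> y"
begin

lemma linear_eps: "linear \<epsilon>"
  by (rule linearI) (simp_all add: eps_add eps_cscale flip: cscale_of_real, simp add: scaleR_conv_of_real)

text \<open>The integral is the Casimir element with \<open>\<epsilon>\<close> applied to its first
  factor: \<open>casimir\<close> gives the invariance and \<open>casimir_one\<close> the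
  normalisation.\<close>

lemma ex_integral:
  obtains e where "e \<in> B" "\<epsilon> e = 1" "\<And>b. b \<in> B \<Longrightarrow> e ** b = cscale (\<epsilon> b) e"
proof
  let ?e = "\<Sum>c\<in>onb B. cscale (\<epsilon> c) (dual c)"
  show "?e \<in> B" by (intro subspace_sum subspace_B cscale_B dual_onb)
  have "\<epsilon> ?e = (\<Sum>c\<in>onb B. \<epsilon> (c ** dual c))"
    by (simp add: linear_sum[OF linear_eps] eps_cscale eps_mult onb_in[OF subspace_B] dual_onb)
  also have "\<dots> = 1" by (simp add: casimir_one eps_one flip: linear_sum[OF linear_eps])
  finally show "\<epsilon> ?e = 1" .
  show "?e ** b = cscale (\<epsilon> b) ?e" if b: "b \<in> B" for b
  proof -
    have "bilinear (\<lambda>x y. cscale (\<epsilon> x) y)"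
      unfolding bilinear_def
      by (auto intro!: linearI simp: eps_add eps_cscale cscale_add_left cscale_add_right mult.commute
          simp flip: cscale_of_real)
    from casimir[OF this b] have
      "(\<Sum>c\<in>onb B. cscale (\<epsilon> (b ** c)) (dual c)) = (\<Sum>c\<in>onb B. cscale (\<epsilon> c) (dual c ** b))" .
    then show ?thesis
      by (simp add: mult_linear_simps cscale_mult_left cscale_sum eps_mult b onb_in[OF subspace_B])
  qed
qed

lemma dim_complex_multiples: "dim (range (\<lambda>c. cscale c v)) = (if v = 0 then 0 else 2)"
proof (cases "v = 0")
  case True
  have "range (\<lambda>c. cscale c v) = {0}" using True by auto
  then show ?thesis using True by (simp only: dim_singleton) simp
next
  case False
  have lin: "linear (\<lambda>c. cscale c v)"
    by (rule linearI) (simp_all add: cscale_add_left flip: cscale_of_real, simp add: scaleR_conv_of_real)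
  have "inj (\<lambda>c. cscale c v)"
  proof (rule injI)
    fix a b assume "cscale a v = cscale b v"
    then show "a = b" using False by (auto simp: vec_eq_iff)
  qed
  then have "dim (range (\<lambda>c. cscale c v)) = dim (UNIV :: complex set)"
    by (intro dim_image_eq[OF lin]) simp
  then show ?thesis using False by simp
qed

text \<open>The integral has rank one on the regular module, while its range on any module is a
  complex space; so its real trace cannot lie strictly between 0 and 2.\<close>

lemma submodule_of_small_char:
  assumes M: "submodule M" and ch: "\<And>b. b \<in> B \<Longrightarrow> char_on M b = r * char_on B b" and r: "r < 1"
  shows "M = {0}"
proof (rule ccontr)
  assume "M \<noteq> {0}"
  then have "\<not> M \<subseteq> {0}" using subspace_0[OF submodule_subspace[OF M]] by blast
  then have "dim M \<noteq> 0" by (simp only: dim_eq_0 not_False_eq_True)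
  then have "dim M > 0" by (simp only: neq0_conv)
  obtain e where e: "e \<in> B" "\<epsilon> e = 1" "\<And>b. b \<in> B \<Longrightarrow> e ** b = cscale (\<epsilon> b) e"
    using ex_integral by blast
  have ee: "e ** e = e" using e by simp
  have "e \<noteq> 0" using e(2) linear_0[OF linear_eps] by auto
  have "(\<lambda>x. e ** x) ` B = range (\<lambda>c. cscale c e)"
  proof
    show "(\<lambda>x. e ** x) ` B \<subseteq> range (\<lambda>c. cscale c e)" using e(3) by auto
    show "range (\<lambda>c. cscale c e) \<subseteq> (\<lambda>x. e ** x) ` B"
    proof
      fix y assume "y \<in> range (\<lambda>c. cscale c e)"
      then obtain c where "y = cscale c e" by auto
      then have "y = e ** cscale c e" by (simp add: cscale_mult_right ee)
      then show "y \<in> (\<lambda>x. e ** x) ` B" using cscale_B[OF e(1)] by blast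
    qed
  qed
  then have chB: "char_on B e = 2"
    using char_on_idempotent[OF submodule_B e(1) ee] dim_complex_multiples[of e] \<open>e \<noteq> 0\<close> by simp
  have "char_on M (mat 1) = dim M"
    using trace_on_id[OF submodule_subspace[OF M]] by (simp add: char_on_def)
  moreover have "char_on B (mat 1) = dim B"
    using trace_on_id[OF subspace_B] by (simp add: char_on_def)
  ultimately have "r * dim B > 0" using ch[OF one_B] \<open>dim M > 0\<close> by simp
  then have "r > 0" by (simp add: zero_less_mult_iff)
  let ?R = "(\<lambda>x. e ** x) ` M"
  have dimR: "real (dim ?R) = 2 * r"
    using char_on_idempotent[OF M e(1) ee] ch[OF e(1)] chB by simp
  with \<open>r > 0\<close> have "dim ?R \<noteq> 0" by (auto simp del: dim_eq_0)
  then have "\<not> ?R \<subseteq> {0}" by (simp only: dim_eq_0 not_False_eq_True)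
  then obtain x where x: "x \<in> M" "e ** x \<noteq> 0" by blast
  \<comment> \<open>A submodule is only required to be a real subspace; complex scalars act on it
    through the elements \<open>cscale c (mat 1)\<close> of \<open>B\<close>, which commute with
    \<open>e\<close>.\<close>
  have "range (\<lambda>c. cscale c (e ** x)) \<subseteq> ?R"
  proof
    fix y assume "y \<in> range (\<lambda>c. cscale c (e ** x))"
    then obtain c where "y = cscale c (e ** x)" by auto
    then have "y = e ** (cscale c (mat 1) ** x)"
      by (simp add: cscale_mult_left cscale_mult_right)
    then show "y \<in> ?R" using submodule_mult[OF M cscale_B[OF one_B] x(1)] by blast
  qed
  then have "dim (range (\<lambda>c. cscale c (e ** x))) \<le> dim ?R" by (rule dim_subset)
  then have "2 \<le> dim ?R" using dim_complex_multiples[of "e ** x"] x(2) by simp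
  then show False using dimR r by linarith
qed

lemma free_of_proportional_char:
  assumes "submodule M" and "\<And>b. b \<in> B \<Longrightarrow> char_on M b = r * char_on B b"
  shows "free_left_module B M"
  by (rule free_of_char[OF submodule_of_small_char assms])

end

section \<open>Coideal subalgebras\<close>

definition tuples :: "'a set \<Rightarrow> ('a^'n::finite) set" where
  "tuples M = {v. \<forall>i. v $ i \<in> M}"

lemma subspace_tuples: "subspace M \<Longrightarrow> subspace (tuples M)"
  by (simp add: subspace_def tuples_def)

lemma linear_axis: "linear (axis i :: 'a::euclidean_space \<Rightarrow> 'a^'n::finite)"
  by (rule linearI) (simp_all add: vec_eq_iff axis_def)

lemma linear_nth: "linear (\<lambda>v :: 'a::euclidean_space^'n::finite. v $ i)"
  by (rule linearI) simp_all

lemma trace_on_tuples: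
  fixes f :: "'a::euclidean_space^'n::finite \<Rightarrow> 'a^'n"
  assumes M: "subspace M" and f: "linear f" and fM: "\<And>v. v \<in> tuples M \<Longrightarrow> f v \<in> tuples M"
  shows "trace_on (tuples M) f = (\<Sum>i\<in>UNIV. trace_on M (\<lambda>x. f (axis i x) $ i))"
proof -
  have "v = (\<Sum>i\<in>UNIV. axis i (v $ i))" for v :: "'a^'n"
    by (simp add: vec_eq_iff axis_def)
  then have "f v = (\<Sum>i\<in>UNIV. f (axis i (v $ i)))" for v
    using linear_sum[OF f] by metis
  then have "trace_on (tuples M) f = trace_on (tuples M) (\<lambda>v. \<Sum>i\<in>UNIV. f (axis i (v $ i)))"
    by (rule trace_on_cong[OF subspace_tuples[OF M]])
  also have "\<dots> = (\<Sum>i\<in>UNIV. trace_on (tuples M) (\<lambda>v. f (axis i (v $ i))))"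
    by (rule trace_on_sum)
  also have "\<dots> = (\<Sum>i\<in>UNIV. trace_on M (\<lambda>x. f (axis i x) $ i))"
  proof (rule sum.cong[OF refl])
    fix i :: 'n
    have lin: "linear (\<lambda>x. f (axis i x))"
      using linear_compose[OF linear_axis f] by (simp add: o_def)
    show "trace_on (tuples M) (\<lambda>v. f (axis i (v $ i))) = trace_on M (\<lambda>x. f (axis i x) $ i)"
      by (rule trace_on_commute[OF subspace_tuples[OF M] M linear_nth lin])
        (use fM subspace_0[OF M] in \<open>auto simp: tuples_def axis_def\<close>)
  qed
  finally show ?thesis .
qed

lemma trace_cscale: "trace (cscale c A) = c * trace A"
  by (simp add: trace_def sum_distrib_left)

lemma trace_on_cscale:
  fixes B :: "(complex^'m::finite^'k::finite) set"
  assumes B: "subspace B"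
  shows "trace_on B (cscale c) = dim B * Re c"
proof -
  have "cscale c x \<bullet> x = Re c * (x \<bullet> x)" for x :: "complex^'m^'k"
    by (simp add: inner_vec_def sum_distrib_left inner_complex_def algebra_simps)
  then show ?thesis
    unfolding trace_on_def by (simp add: onb_inner[OF B] card_onb[OF B])
qed

text \<open>\<open>D k i x\<close> is the block \<open>(k, i)\<close> of the coproduct of \<open>x\<close>, cut along one of the two legs.\<close>

locale hopf_blocks =
  fixes S :: "(complex^'n^'n::finite) set"
    and D :: "'n \<Rightarrow> 'n \<Rightarrow> complex^'n^'n \<Rightarrow> complex^'n^'n"
    and \<epsilon> :: "complex^'n^'n \<Rightarrow> complex"
  assumes S_add: "\<And>x y. x \<in> S \<Longrightarrow> y \<in> S \<Longrightarrow> x + y \<in> S"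
    and S_cscale: "\<And>c x. x \<in> S \<Longrightarrow> cscale c x \<in> S"
    and S_mult: "\<And>x y. x \<in> S \<Longrightarrow> y \<in> S \<Longrightarrow> x ** y \<in> S"
    and S_one: "mat 1 \<in> S"
    and D_linear: "\<And>k i. linear (D k i)"
    and D_mult: "\<And>k i x y. x \<in> S \<Longrightarrow> y \<in> S \<Longrightarrow> D k i (x ** y) = (\<Sum>l\<in>UNIV. D k l x ** D l i y)"
    and D_S: "\<And>k i x. x \<in> S \<Longrightarrow> D k i x \<in> S"
    and D_diag: "\<And>x. x \<in> S \<Longrightarrow> (\<Sum>i\<in>UNIV. D i i x) = cscale (trace x) (mat 1)"
    and D_trace: "\<And>k i x. x \<in> S \<Longrightarrow> trace (D k i x) = (if k = i then trace x else 0)"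
    and D_counit: "\<And>k i x. x \<in> S \<Longrightarrow> \<epsilon> (D k i x) = x $ k $ i"
    and D_surj: "\<And>j x. x \<in> S \<Longrightarrow> \<exists>g. (\<forall>i. g i \<in> S) \<and>
      (\<forall>k. (\<Sum>i\<in>UNIV. D k i (g i)) = (if k = j then x else 0))"
    and eps_add: "\<And>x y. \<epsilon> (x + y) = \<epsilon> x + \<epsilon> y"
    and eps_cscale: "\<And>c x. \<epsilon> (cscale c x) = c * \<epsilon> x"
    and eps_one: "\<epsilon> (mat 1) = 1"
    and eps_mult: "\<And>x y. x \<in> S \<Longrightarrow> y \<in> S \<Longrightarrow> \<epsilon> (x ** y) = \<epsilon> x * \<epsilon> y"
begin

lemma subspace_of_complex:
  assumes "mat 1 \<in> B" "\<And>x y. x \<in> B \<Longrightarrow> y \<in> B \<Longrightarrow> x + y \<in> B"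
    "\<And>c x. x \<in> B \<Longrightarrow> cscale c x \<in> B"
  shows "subspace B"
  unfolding subspace_def using assms assms(3)[of "mat 1" 0]
  by (auto simp flip: cscale_of_real)

lemma subspace_S: "subspace S"
  by (rule subspace_of_complex[OF S_one S_add S_cscale])

text \<open>The operator \<open>b \<otimes> \<eta> \<mapsto> \<delta>(b)(1 \<otimes> \<eta>)\<close>, with a vector of matrices standing for an element
  of \<open>S \<otimes> H\<close>.\<close>

definition galois :: "(complex^'n^'n)^'n \<Rightarrow> (complex^'n^'n)^'n" where
  "galois v = (\<chi> k. \<Sum>i\<in>UNIV. D k i (v $ i))"

lemma galois_nth: "galois v $ k = (\<Sum>i\<in>UNIV. D k i (v $ i))"
  by (simp add: galois_def)

lemma linear_galois: "linear galois"
  by (rule linearI)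
    (simp_all add: vec_eq_iff galois_nth linear_add[OF D_linear] linear_scale[OF D_linear]
      sum.distrib scaleR_sum_right flip: vec_eq_iff[of "_ :: complex^'n"] vec_eq_iff[of "_ :: complex^'n^'n"])

lemma galois_image_S: "galois ` tuples S = tuples S"
proof
  show "galois ` tuples S \<subseteq> tuples S"
    by (auto simp: tuples_def galois_nth intro!: subspace_sum[OF subspace_S] D_S)
  show "tuples S \<subseteq> galois ` tuples S"
  proof
    fix w :: "(complex^'n^'n)^'n" assume "w \<in> tuples S"
    then have "\<exists>g. (\<forall>i. g i \<in> S) \<and> (\<forall>k. (\<Sum>i\<in>UNIV. D k i (g i)) = (if k = j then w $ j else 0))" for j
      by (intro D_surj) (simp add: tuples_def)
    then obtain g where g: "\<And>j i. g j i \<in> S"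
      "\<And>j k. (\<Sum>i\<in>UNIV. D k i (g j i)) = (if k = j then w $ j else 0)"
      by metis
    let ?v = "\<chi> i. \<Sum>j\<in>UNIV. g j i"
    have "galois ?v $ k = w $ k" for k
    proof -
      have "galois ?v $ k = (\<Sum>i\<in>UNIV. \<Sum>j\<in>UNIV. D k i (g j i))"
        by (simp add: galois_nth linear_sum[OF D_linear])
      also have "\<dots> = (\<Sum>j\<in>UNIV. \<Sum>i\<in>UNIV. D k i (g j i))" by (rule sum.swap)
      also have "\<dots> = w $ k" by (simp add: g(2))
      finally show ?thesis .
    qed
    then have "galois ?v = w" by (simp add: vec_eq_iff[of "galois ?v"])
    moreover have "?v \<in> tuples S" using g(1) by (simp add: tuples_def subspace_sum[OF subspace_S])
    ultimately show "w \<in> galois ` tuples S" by blast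
  qed
qed

end

locale coideal = hopf_blocks S D \<epsilon>
  for S :: "(complex^'n^'n::finite) set" and D \<epsilon> +
  fixes B :: "(complex^'n^'n::finite) set"
  assumes B_S: "B \<subseteq> S"
    and B_one: "mat 1 \<in> B"
    and B_add: "\<And>x y. x \<in> B \<Longrightarrow> y \<in> B \<Longrightarrow> x + y \<in> B"
    and B_cscale: "\<And>c x. x \<in> B \<Longrightarrow> cscale c x \<in> B"
    and B_mult: "\<And>x y. x \<in> B \<Longrightarrow> y \<in> B \<Longrightarrow> x ** y \<in> B"
    and D_B: "\<And>k i x. x \<in> B \<Longrightarrow> D k i x \<in> B"
begin

lemma subspace_B: "subspace B"
  by (rule subspace_of_complex[OF B_one B_add B_cscale])

lemma inj_on_galois: "inj_on galois (tuples B)"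
  using inj_on_of_image_eq[OF subspace_tuples[OF subspace_S] linear_galois galois_image_S]
  by (rule inj_on_subset) (use B_S in \<open>auto simp: tuples_def\<close>)

text \<open>The preimages from \<open>D_surj\<close> lie in \<open>S\<close> but possibly outside
  \<open>B\<close>. Surjectivity on \<open>S\<close> gives injectivity there, which restricts to
  \<open>B\<close>, and a dimension count turns it back into surjectivity.\<close>

lemma galois_image_B: "galois ` tuples B = tuples B"
  by (rule image_eq_of_inj_on[OF subspace_tuples[OF subspace_B] linear_galois inj_on_galois])
    (auto simp: tuples_def galois_nth intro!: subspace_sum[OF subspace_B] D_B)

text \<open>\<open>galois\<close> carries the action of \<open>b\<close> on the first factor of
  \<open>B \<otimes> H\<close> to left multiplication by the coproduct of \<open>b\<close>. The
  former has \<open>CARD('n)\<close> times the character as its trace; for the latter only diagonal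
  blocks count, and \<open>D_diag\<close> makes their sum a scalar.\<close>

lemma char_on_B:
  assumes b: "b \<in> B"
  shows "CARD('n) * char_on B b = dim B * Re (trace b)"
proof -
  let ?f = "\<lambda>v. (\<chi> k. b ** (v $ k)) :: (complex^'n^'n)^'n"
  let ?g = "\<lambda>v. (\<chi> k. \<Sum>l\<in>UNIV. D k l b ** (v $ l)) :: (complex^'n^'n)^'n"
  have f: "linear ?f" and g: "linear ?g"
    by (rule linearI; simp add: vec_eq_iff[where 'a = "complex^'n^'n"] mult_linear_simps sum.distrib
        scaleR_sum_right)+
  have fB: "?f v \<in> tuples B" if "v \<in> tuples B" for v
    using that b B_mult by (auto simp: tuples_def)
  have gB: "?g v \<in> tuples B" if "v \<in> tuples B" for v
    using that b by (auto simp: tuples_def intro!: subspace_sum[OF subspace_B] B_mult D_B)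
  have "trace_on (tuples B) ?f = trace_on (tuples B) ?g"
  proof (rule trace_on_iso[OF subspace_tuples[OF subspace_B] linear_galois inj_on_galois
        galois_image_B f g fB])
    fix v :: "(complex^'n^'n)^'n" assume v: "v \<in> tuples B"
    have "galois (?f v) $ k = ?g (galois v) $ k" for k
    proof -
      have "galois (?f v) $ k = (\<Sum>i\<in>UNIV. \<Sum>l\<in>UNIV. D k l b ** D l i (v $ i))"
        using v b B_S by (simp add: galois_nth D_mult tuples_def subset_iff)
      also have "\<dots> = (\<Sum>l\<in>UNIV. \<Sum>i\<in>UNIV. D k l b ** D l i (v $ i))" by (rule sum.swap)
      finally show ?thesis by (simp add: galois_nth mult_linear_simps)
    qed
    then show "galois (?f v) = ?g (galois v)" by (rule iffD2[OF vec_eq_iff, OF allI])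
  qed
  moreover have "trace_on (tuples B) ?f = CARD('n) * char_on B b"
    by (simp add: trace_on_tuples[OF subspace_B f fB] char_on_def)
  moreover have "trace_on (tuples B) ?g = dim B * Re (trace b)"
  proof -
    have "D i l b ** axis j x $ l = (if l = j then D i l b ** x else 0)" for i l j and x :: "complex^'n^'n"
      by (simp add: axis_def mult_linear_simps)
    then have "trace_on (tuples B) ?g = (\<Sum>i\<in>UNIV. trace_on B (\<lambda>x. D i i b ** x))"
      by (simp add: trace_on_tuples[OF subspace_B g gB])
    also have "\<dots> = trace_on B (\<lambda>x. (\<Sum>i\<in>UNIV. D i i b) ** x)"
      by (simp add: mult_linear_simps trace_on_sum)
    also have "\<dots> = trace_on B (cscale (trace b))"
      using b B_S by (simp add: D_diag subset_iff cscale_mult_left)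
    finally show ?thesis by (simp add: trace_on_cscale[OF subspace_B])
  qed
  ultimately show ?thesis by simp
qed

section \<open>The radical of the trace form\<close>

definition radical :: "(complex^'n^'n) set" where
  "radical = {a \<in> B. \<forall>b\<in>B. trace (a ** b) = 0}"

text \<open>The column with \<open>b\<close> in slot \<open>i\<close> is \<open>galois v\<close> for
  some \<open>v\<close> over \<open>B\<close>. Multiplicativity of the coproduct then rewrites the
  product as the sum of the \<open>D k j (a ** v $ j)\<close>, and by \<open>D_trace\<close> the
  trace of each is zero or that of \<open>a ** v $ j\<close>, which vanishes as well.\<close>

lemma radical_blocks:
  assumes a: "a \<in> radical"
  shows "D k i a \<in> radical"
proof -
  have aB: "a \<in> B" using a by (simp add: radical_def)
  have "trace (D k i a ** b) = 0" if b: "b \<in> B" for b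
  proof -
    have "(axis i b :: (complex^'n^'n)^'n) \<in> galois ` tuples B"
      unfolding galois_image_B using b subspace_0[OF subspace_B] by (auto simp: tuples_def axis_def)
    then obtain v where v: "v \<in> tuples B" "axis i b = galois v" by blast
    have vB: "v $ j \<in> B" for j using v by (simp add: tuples_def)
    have "D k i a ** b = (\<Sum>l\<in>UNIV. D k l a ** (axis i b $ l))"
      by (simp add: axis_def mult_linear_simps if_distrib[of "\<lambda>x. _ ** x"] cong: if_cong)
    also have "\<dots> = (\<Sum>l\<in>UNIV. \<Sum>j\<in>UNIV. D k l a ** D l j (v $ j))"
      by (simp add: v(2) galois_nth mult_linear_simps)
    also have "\<dots> = (\<Sum>j\<in>UNIV. \<Sum>l\<in>UNIV. D k l a ** D l j (v $ j))" by (rule sum.swap)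
    also have "\<dots> = (\<Sum>j\<in>UNIV. D k j (a ** v $ j))"
      using aB vB B_S by (simp add: D_mult subset_iff)
    finally have "trace (D k i a ** b) = (\<Sum>j\<in>UNIV. trace (D k j (a ** v $ j)))"
      by (simp add: trace_def) (rule sum.swap)
    also have "\<dots> = 0"
      using a vB B_S aB B_mult by (intro sum.neutral) (simp add: D_trace subset_iff radical_def)
    finally show ?thesis .
  qed
  then show ?thesis using D_B[OF aB] by (simp add: radical_def)
qed

text \<open>A right ideal of minimal dimension on which \<open>\<epsilon>\<close> does not vanish contains a nonzero
  idempotent, whose trace is not zero.\<close>

lemma eps_radical:
  assumes a: "a \<in> radical"
  shows "\<epsilon> a = 0"
proof (rule ccontr)
  assume "\<epsilon> a \<noteq> 0"
  define P where "P N \<longleftrightarrow> subspace N \<and> N \<subseteq> radical \<and> (\<forall>x\<in>N. \<forall>b\<in>B. x ** b \<in> N) \<and> (\<exists>x\<in>N. \<epsilon> x \<noteq> 0)"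
    for N
  have radB: "x \<in> radical \<Longrightarrow> x \<in> B" for x by (simp add: radical_def)
  have trace_linear: "trace (x + y) = trace x + trace y" "trace (r *\<^sub>R x) = r *\<^sub>R trace x"
    for x y :: "complex^'n^'n" and r
    by (simp_all add: trace_def sum.distrib scaleR_sum_right)
  have "subspace radical"
    using subspace_B
    by (auto simp: subspace_def radical_def mult_linear_simps trace_linear matrix_add_mult_distrib trace_def[of 0])
  moreover have "x ** b \<in> radical" if "x \<in> radical" "b \<in> B" for x b
    using that B_mult by (auto simp: radical_def simp flip: matrix_mul_assoc)
  ultimately have "P radical" using a \<open>\<epsilon> a \<noteq> 0\<close> by (auto simp: P_def)
  then obtain N where N: "P N" and min: "\<And>N'. P N' \<Longrightarrow> dim N \<le> dim N'"
    using ex_has_least_nat[of P radical dim] by blast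
  have sN: "subspace N" and NR: "N \<subseteq> radical" and Nid: "\<And>x b. x \<in> N \<Longrightarrow> b \<in> B \<Longrightarrow> x ** b \<in> N"
    using N by (auto simp: P_def)
  obtain x where x: "x \<in> N" "\<epsilon> x \<noteq> 0" using N by (auto simp: P_def)
  have xB: "x \<in> B" using x NR radB by blast
  let ?xN = "(\<lambda>y. x ** y) ` N"
  have sub: "?xN \<subseteq> N" using Nid x NR radB by blast
  have sxN: "subspace ?xN" by (rule linear_subspace_image[OF linear_mult_left sN])
  have "P ?xN"
    unfolding P_def
  proof (intro conjI ballI)
    show "subspace ?xN" by (rule sxN)
    show "?xN \<subseteq> radical" using sub NR by blast
    show "y ** b \<in> ?xN" if "y \<in> ?xN" "b \<in> B" for y b
      using that Nid by (auto simp flip: matrix_mul_assoc)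
    have "\<epsilon> (x ** x) \<noteq> 0" using x xB B_S by (simp add: eps_mult subset_iff)
    then show "\<exists>y\<in>?xN. \<epsilon> y \<noteq> 0" using x(1) by blast
  qed
  \<comment> \<open>By minimality \<open>x\<close> acts bijectively on \<open>N\<close> from the
    left. Hence some \<open>f\<close> in \<open>N\<close> satisfies \<open>x ** f = x\<close>, and
    cancelling \<open>x\<close> in \<open>x ** (f ** f) = x ** f\<close> makes \<open>f\<close>
    idempotent.\<close>
  then have im: "?xN = N" by (intro subspace_dim_equal sxN sN sub min)
  then have inj: "inj_on (\<lambda>y. x ** y) N" by (rule inj_on_of_image_eq[OF sN linear_mult_left])
  obtain f where f: "f \<in> N" "x = x ** f" using im x(1) by blast
  have fB: "f \<in> B" using f NR radB by blast
  have "x ** (f ** f) = x ** f" using f(2) by (simp add: matrix_mul_assoc)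
  then have ff: "f ** f = f" using inj f(1) Nid[OF f(1) fB] by (auto dest: inj_onD)
  have "f \<noteq> 0" using f(2) x(2) eps_cscale[of 0 x] by (auto simp: mult_linear_simps)
  have "trace (f ** mat 1) = 0" using f(1) NR B_one unfolding radical_def by blast
  then have "char_on B f = 0" using char_on_B[OF fB] by simp
  moreover have "char_on B f = dim ((\<lambda>y. f ** y) ` B)"
    unfolding char_on_def
    by (rule trace_on_idempotent[OF subspace_B linear_mult_left])
      (use fB ff B_mult in \<open>auto simp: matrix_mul_assoc\<close>)
  ultimately have "dim ((\<lambda>y. f ** y) ` B) = 0" by simp
  then have "(\<lambda>y. f ** y) ` B \<subseteq> {0}" by (simp only: dim_eq_0)
  then have "f ** f = 0" using fB by blast
  then show False using ff \<open>f \<noteq> 0\<close> by simp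
qed

text \<open>The counit of the block \<open>D k i a\<close> is the entry \<open>a $ k $ i\<close>,
  and the blocks stay in the radical.\<close>

lemma radical_trivial: "a \<in> radical \<Longrightarrow> a = 0"
  using D_counit[of a] eps_radical[OF radical_blocks] B_S
  by (auto simp: vec_eq_iff radical_def subset_iff)

sublocale augmented_algebra B \<epsilon>
proof
  show "subspace B" by (rule subspace_B)
  show "mat 1 \<in> B" by (rule B_one)
  show "x ** y \<in> B" if "x \<in> B" "y \<in> B" for x y using that by (rule B_mult)
  show "cscale c x \<in> B" if "x \<in> B" for c x using that by (rule B_cscale)
  show "\<epsilon> (x ** y) = \<epsilon> x * \<epsilon> y" if "x \<in> B" "y \<in> B" for x y
    using that B_S by (intro eps_mult) auto
  show "a = 0" if a: "a \<in> B" and z: "\<And>b. b \<in> B \<Longrightarrow> char_on B (a ** b) = 0" for a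
  proof (rule radical_trivial)
    have "dim B \<noteq> 0"
    proof
      assume "dim B = 0"
      then have "B \<subseteq> {0}" by (simp only: dim_eq_0)
      then have "mat 1 = (0 :: complex^'n^'n)" using B_one by blast
      then have "(mat 1 :: complex^'n^'n) $ i $ i = 0" for i by simp
      then show False by (simp add: mat_def)
    qed
    then have re: "Re (trace (a ** b)) = 0" if "b \<in> B" for b
      using char_on_B[OF B_mult[OF a that]] z[OF that] by simp
    \<comment> \<open>The real character sees only the real part of the trace; testing against
      \<open>cscale \<i> b\<close> recovers the imaginary part.\<close>
    have "trace (a ** b) = 0" if b: "b \<in> B" for b
      using re[OF b] re[OF B_cscale[OF b, of \<i>]]
      by (simp add: cscale_mult_right trace_cscale complex_eq_iff)
    then show "a \<in> radical" using a by (simp add: radical_def)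
  qed
qed (rule eps_add eps_cscale eps_one)+

lemma free_left_module_S: "free_left_module B S"
proof -
  interpret S: coideal S D \<epsilon> S
    by standard (auto intro: S_one S_add S_cscale S_mult D_S)
  have dim: "dim B \<noteq> 0"
  proof
    assume "dim B = 0"
    then have "B \<subseteq> {0}" by (simp only: dim_eq_0)
    then have "\<epsilon> (mat 1) = \<epsilon> 0" using B_one by fastforce
    then show False using eps_one eps_cscale[of 0 0] by simp
  qed
  show ?thesis
  proof (rule free_of_proportional_char[where r = "dim S / dim B"])
    show "submodule S" using B_S S_mult subspace_S by (auto simp: submodule_def)
    fix b assume b: "b \<in> B"
    have "CARD('n) * char_on S b = dim S * Re (trace b)" using S.char_on_B b B_S by blast
    moreover have "CARD('n) * char_on B b = dim B * Re (trace b)" by (rule char_on_B[OF b])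
    ultimately have "CARD('n) * (char_on S b * dim B) = CARD('n) * (dim S * char_on B b)"
      by algebra
    then have "char_on S b * dim B = dim S * char_on B b" by simp
    then show "char_on S b = dim S / dim B * char_on B b"
      using dim by (simp add: field_simps)
  qed
qed

end

section \<open>Multiplicative unitaries\<close>

lemma sum_pair: "(\<Sum>z\<in>UNIV. f z) = (\<Sum>a\<in>UNIV. \<Sum>b\<in>UNIV. f (a :: 'a::finite, b :: 'b::finite))"
  by (simp add: sum.cartesian_product)

lemma madj_nth [simp]: "madj A $ i $ j = cnj (A $ j $ i)"
  by (simp add: madj_def)

lemma madj_madj [simp]: "madj (madj A) = A"
  by (simp add: vec_eq_iff)

lemma madj_mult: "madj (A ** B) = madj B ** madj A"
  by (simp add: vec_eq_iff matrix_matrix_mult_def mult.commute)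

lemma madj_add: "madj (A + B) = madj A + madj B"
  by (simp add: vec_eq_iff)

lemma madj_cscale: "madj (cscale c A) = cscale (cnj c) (madj A)"
  by (simp add: vec_eq_iff)

lemma madj_one [simp]: "madj (mat 1) = mat 1"
  by (simp add: vec_eq_iff mat_def)

lemma madj_zero [simp]: "madj 0 = 0"
  by (simp add: vec_eq_iff)

lemma madj_sum: "madj (sum f I) = (\<Sum>i\<in>I. madj (f i))"
  by (simp add: vec_eq_iff)

lemma madj_eq_0 [simp]: "madj A = 0 \<longleftrightarrow> A = 0"
  by (metis madj_madj madj_zero)

lemma free_right_module_of_adjoint:
  assumes free: "free_left_module (madj ` B) M" and M: "\<And>x. x \<in> M \<Longrightarrow> madj x \<in> M"
  shows "free_right_module B M"
proof -
  obtain k s where s: "\<forall>t<(k::nat). s t \<in> M"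
    "\<forall>x\<in>M. \<exists>b. (\<forall>t<k. b t \<in> madj ` B) \<and> x = (\<Sum>t<k. b t ** s t)"
    "\<forall>b. (\<forall>t<k. b t \<in> madj ` B) \<and> (\<Sum>t<k. b t ** s t) = 0 \<longrightarrow> (\<forall>t<k. b t = 0)"
    using free unfolding free_left_module_def by blast
  have sum_eq: "madj (\<Sum>t<k. b t ** s t) = (\<Sum>t<k. madj (s t) ** madj (b t))" for b
    by (simp add: madj_sum madj_mult)
  show ?thesis
    unfolding free_right_module_def
  proof (rule exI[of _ k], rule exI[of _ "\<lambda>t. madj (s t)"], intro conjI ballI allI impI)
    show "madj (s t) \<in> M" if "t < k" for t using that s(1) M by blast
  next
    fix x assume "x \<in> M"
    then obtain b where b: "\<forall>t<k. b t \<in> madj ` B" "madj x = (\<Sum>t<k. b t ** s t)"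
      using s(2) M by blast
    have "x = (\<Sum>t<k. madj (s t) ** madj (b t))" using arg_cong[OF b(2), of madj] sum_eq by simp
    moreover have "\<forall>t<k. madj (b t) \<in> B" using b(1) by auto
    ultimately show "\<exists>b. (\<forall>t<k. b t \<in> B) \<and> x = (\<Sum>t<k. madj (s t) ** b t)"
      by (intro exI[of _ "\<lambda>t. madj (b t)"]) simp
  next
    fix b t assume b: "(\<forall>t<k. b t \<in> B) \<and> (\<Sum>t<k. madj (s t) ** b t) = 0" and t: "t < k"
    have "(\<Sum>t<k. madj (b t) ** s t) = 0"
      using arg_cong[OF conjunct2[OF b], of madj] by (simp add: madj_sum madj_mult)
    then have "\<forall>t<k. madj (b t) = 0" using s(3)[rule_format, of "\<lambda>t. madj (b t)"] b by blast
    then show "b t = 0" using t by simp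
  qed
qed

lemma inner_matrix_vector_adjoint:
  fixes A :: "complex^'m::finite^'m"
  shows "(A *v x) \<bullet> y = x \<bullet> (madj A *v y)"
proof -
  have *: "(a * s) \<bullet> t = s \<bullet> (cnj a * t)" for a s t :: complex
    by (simp add: inner_complex_def algebra_simps)
  have "(A *v x) \<bullet> y = (\<Sum>i\<in>UNIV. \<Sum>j\<in>UNIV. (A $ i $ j * x $ j) \<bullet> y $ i)"
    by (simp add: inner_vec_def matrix_vector_mult_def inner_sum_left)
  also have "\<dots> = (\<Sum>j\<in>UNIV. \<Sum>i\<in>UNIV. x $ j \<bullet> (cnj (A $ i $ j) * y $ i))"
    unfolding * by (rule sum.swap)
  finally show ?thesis by (simp add: inner_vec_def matrix_vector_mult_def inner_sum_right)
qed

lemma unitary_inner_self: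
  assumes "unitary A"
  shows "(A *v x) \<bullet> (A *v x) = x \<bullet> x"
  using assms by (simp add: inner_matrix_vector_adjoint matrix_vector_mul_assoc unitary_def)

section \<open>Blocks of operators on a tensor product\<close>

definition block1 :: "'a \<Rightarrow> 'a \<Rightarrow> complex^('a::finite \<times> 'b::finite)^('a \<times> 'b) \<Rightarrow> complex^'b^'b" where
  "block1 i k X = (\<chi> j l. X $ (i, j) $ (k, l))"

definition block2 :: "'b \<Rightarrow> 'b \<Rightarrow> complex^('a::finite \<times> 'b::finite)^('a \<times> 'b) \<Rightarrow> complex^'a^'a" where
  "block2 j l X = (\<chi> i k. X $ (i, j) $ (k, l))"

lemma block_nth [simp]:
  "block1 i k X $ j $ l = X $ (i, j) $ (k, l)" "block2 j l X $ i $ k = X $ (i, j) $ (k, l)"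
  by (simp_all add: block1_def block2_def)

lemma block1_mult: "block1 i k (X ** Y) = (\<Sum>r\<in>UNIV. block1 i r X ** block1 r k Y)"
  by (simp add: vec_eq_iff matrix_matrix_mult_def sum_pair)

lemma block2_mult: "block2 j l (X ** Y) = (\<Sum>r\<in>UNIV. block2 j r X ** block2 r l Y)"
  by (simp add: vec_eq_iff matrix_matrix_mult_def sum_pair, subst sum.swap) simp

lemma linear_block: "linear (block1 i k)" "linear (block2 j l)"
  by (rule linearI; simp add: vec_eq_iff)+

lemma block_one:
  "block1 i k (mat 1) = (if i = k then mat 1 else 0)" "block2 j l (mat 1) = (if j = l then mat 1 else 0)"
  by (auto simp: vec_eq_iff mat_def)

lemma block_madj: "block1 i k (madj X) = madj (block1 k i X)" "block2 j l (madj X) = madj (block2 l j X)"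
  by (simp_all add: vec_eq_iff)

lemma block_eqI: "(\<And>i k. block1 i k X = block1 i k Y) \<Longrightarrow> X = Y"
  by (simp add: vec_eq_iff)

lemma tensor_op_nth [simp]: "tensor_op a b $ (i, j) $ (k, l) = a $ i $ k * b $ j $ l"
  by (simp add: tensor_op_def)

lemma block_tensor:
  "block1 i k (tensor_op a b) = cscale (a $ i $ k) b" "block2 j l (tensor_op a b) = cscale (b $ j $ l) a"
  by (simp_all add: vec_eq_iff mult.commute)

lemma tensor_op_mult: "tensor_op a b ** tensor_op c d = tensor_op (a ** c) (b ** d)"
  by (simp add: vec_eq_iff matrix_matrix_mult_def sum_pair sum_product algebra_simps)

lemma madj_tensor: "madj (tensor_op a b) = tensor_op (madj a) (madj b)"
  by (simp add: vec_eq_iff)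

lemma trace_sum: "trace (sum f I) = (\<Sum>i\<in>I. trace (f i :: complex^'m::finite^'m))"
  by (simp add: trace_def) (rule sum.swap)

lemma cscale_sum_left: "cscale (sum f I) A = (\<Sum>i\<in>I. cscale (f i) A)"
  by (simp add: vec_eq_iff sum_distrib_right)

lemma trace_tensor: "trace (tensor_op a b) = trace a * trace b"
  by (simp add: trace_def sum_pair sum_product)

lemma linear_tensor_one: "linear (\<lambda>x. tensor_op x (mat 1))"
  by (rule linearI) (simp_all add: vec_eq_iff algebra_simps)

text \<open>The defect \<open>V (\<xi> \<otimes> e) - \<xi> \<otimes> e\<close>, squared and summed over an orthonormal basis,
  only depends on \<open>(id \<otimes> trace)(V) \<xi>\<close>.\<close>

lemma fixed_of_partial_trace:
  fixes V :: "('n::finite) op2"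
  assumes V: "unitary V"
    and \<xi>: "\<And>p. (\<Sum>q\<in>UNIV. trace (block1 p q V) * \<xi> $ q) = of_nat CARD('n) * \<xi> $ p"
  shows "(\<Sum>q\<in>UNIV. V $ (p, j) $ (q, l) * \<xi> $ q) = (if j = l then \<xi> $ p else 0)"
proof -
  define z where "z l = tensor_vec \<xi> (axis l 1)" for l
  have z_nth: "z l $ (p, j) = (if j = l then \<xi> $ p else 0)" for l p j
    by (simp add: z_def tensor_vec_def axis_def)
  have Vz: "(V *v z l) $ (p, j) = (\<Sum>q\<in>UNIV. V $ (p, j) $ (q, l) * \<xi> $ q)" for l p j
    by (simp add: matrix_vector_mult_def sum_pair z_nth if_distrib[of "\<lambda>t. _ * t"] cong: if_cong)
  have zz: "z l \<bullet> z l = \<xi> \<bullet> \<xi>" for l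
  proof -
    have "z l $ (p, j) \<bullet> z l $ (p, j) = (if j = l then \<xi> $ p \<bullet> \<xi> $ p else 0)" for p j
      by (simp add: z_nth)
    then show ?thesis by (simp add: inner_vec_def sum_pair)
  qed
  have Vzz: "(V *v z l) \<bullet> z l = (\<Sum>p\<in>UNIV. (V *v z l) $ (p, l) \<bullet> \<xi> $ p)" for l
  proof -
    have "(V *v z l) $ (p, j) \<bullet> z l $ (p, j) = (if j = l then (V *v z l) $ (p, l) \<bullet> \<xi> $ p else 0)"
      for p j by (simp add: z_nth)
    then show ?thesis by (simp add: inner_vec_def[of "V *v z l"] sum_pair)
  qed
  have "(\<Sum>l\<in>UNIV. (V *v z l) $ (p, l)) = of_nat CARD('n) * \<xi> $ p" for p
    unfolding Vz \<xi>[symmetric] trace_def sum_distrib_right block_nth by (rule sum.swap)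
  then have "(\<Sum>l\<in>UNIV. (V *v z l) \<bullet> z l) = (\<Sum>p\<in>UNIV. (of_nat CARD('n) * \<xi> $ p) \<bullet> \<xi> $ p)"
    unfolding Vzz by (subst sum.swap) (simp add: inner_sum_left[symmetric])
  also have "\<dots> = CARD('n) * (\<xi> \<bullet> \<xi>)"
    by (simp add: inner_vec_def sum_distrib_left inner_complex_def algebra_simps)
  finally have tr: "(\<Sum>l\<in>UNIV. (V *v z l) \<bullet> z l) = CARD('n) * (\<xi> \<bullet> \<xi>)" .
  have "(V *v z l - z l) \<bullet> (V *v z l - z l) = 2 * (\<xi> \<bullet> \<xi>) - 2 * ((V *v z l) \<bullet> z l)" for l
    by (simp add: inner_diff_left inner_diff_right unitary_inner_self[OF V] zz inner_commute)
  then have "(\<Sum>l\<in>UNIV. (V *v z l - z l) \<bullet> (V *v z l - z l)) = 0"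
    by (simp add: sum_subtractf flip: sum_distrib_left) (simp add: tr)
  then have "V *v z l - z l = 0" by (simp add: sum_nonneg_eq_0_iff)
  then have "(V *v z l) $ (p, j) = z l $ (p, j)" by simp
  then show ?thesis unfolding Vz z_nth .
qed

lemma leg_one: "leg12 (mat 1) = mat 1" "leg23 (mat 1) = mat 1"
  unfolding leg12_def leg23_def by (auto simp: vec_eq_iff mat_def)

lemma block1_leg:
  "block1 p q (leg12 V) = tensor_op (block1 p q V) (mat 1)"
  "block1 p q (leg13 V) = tensor_op (mat 1) (block1 p q V)"
  "block1 p q (leg23 V) = (if p = q then V else 0)"
  unfolding leg12_def leg13_def leg23_def by (auto simp: vec_eq_iff mat_def)

lemma leg_mult:
  "leg12 (A ** B) = leg12 A ** leg12 B" "leg23 (A ** B) = leg23 A ** leg23 B"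
proof (rule_tac [!] block_eqI)
  fix i k
  show "block1 i k (leg12 (A ** B)) = block1 i k (leg12 A ** leg12 B)"
    by (simp add: block1_mult block1_leg tensor_op_mult linear_sum[OF linear_tensor_one])
  have "block1 i r (leg23 A) ** block1 r k (leg23 B) = (if r = i then if i = k then A ** B else 0 else 0)" for r
    by (simp add: block1_leg mult_linear_simps)
  then show "block1 i k (leg23 (A ** B)) = block1 i k (leg23 A ** leg23 B)"
    by (simp add: block1_mult block1_leg(3))
qed

text \<open>The unit lies in \<open>Salg V\<close> as soon as a coideal subalgebra exists. It is
  used to bring the adjoints of the coefficients of \<open>V\<close> into
  \<open>Salg V\<close>.\<close>

locale mult_unitary =
  fixes V :: "('n::finite) op2"
  assumes mult_unitary: "multiplicative_unitary V"
    and one_Salg: "mat 1 \<in> Salg V"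
begin

lemma unitary_V: "V ** madj V = mat 1" "madj V ** V = mat 1"
  using mult_unitary by (auto simp: multiplicative_unitary_def unitary_def)

lemma unitary_V_cancel: "madj V ** (V ** X) = X" "V ** (madj V ** X) = X"
  by (simp_all add: matrix_mul_assoc unitary_V)

lemma pentagon: "leg12 V ** leg13 V ** leg23 V = leg23 V ** leg12 V"
  using mult_unitary by (simp add: multiplicative_unitary_def)

abbreviation u :: "'n \<Rightarrow> 'n \<Rightarrow> 'n op1" where
  "u p q \<equiv> block1 p q V"

abbreviation T :: "'n \<Rightarrow> 'n \<Rightarrow> complex" where
  "T p q \<equiv> trace (u p q)"

lemma slice_eq: "slice w V = (\<Sum>i\<in>UNIV. \<Sum>k\<in>UNIV. cscale (w $ i $ k) (u i k))"
  by (simp add: slice_def vec_eq_iff)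

lemma Salg_iff: "x \<in> Salg V \<longleftrightarrow> (\<exists>w. x = (\<Sum>i\<in>UNIV. \<Sum>k\<in>UNIV. cscale (w i k) (u i k)))"
proof
  show "\<exists>w. x = (\<Sum>i\<in>UNIV. \<Sum>k\<in>UNIV. cscale (w i k) (u i k))" if x: "x \<in> Salg V"
  proof -
    obtain w where "x = slice w V" using x by (auto simp: Salg_def)
    then show ?thesis unfolding slice_eq by (intro exI[of _ "\<lambda>i k. w $ i $ k"])
  qed
  assume "\<exists>w. x = (\<Sum>i\<in>UNIV. \<Sum>k\<in>UNIV. cscale (w i k) (u i k))"
  then obtain w where "x = (\<Sum>i\<in>UNIV. \<Sum>k\<in>UNIV. cscale (w i k) (u i k))" ..
  then have "x = slice (\<chi> i k. w i k) V" by (simp add: slice_eq)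
  then show "x \<in> Salg V" by (auto simp: Salg_def)
qed

lemma Salg_add: "x \<in> Salg V \<Longrightarrow> y \<in> Salg V \<Longrightarrow> x + y \<in> Salg V"
proof -
  assume "x \<in> Salg V" "y \<in> Salg V"
  then obtain v w where "x = (\<Sum>i\<in>UNIV. \<Sum>k\<in>UNIV. cscale (v i k) (u i k))"
    "y = (\<Sum>i\<in>UNIV. \<Sum>k\<in>UNIV. cscale (w i k) (u i k))"
    unfolding Salg_iff by blast
  then have "x + y = (\<Sum>i\<in>UNIV. \<Sum>k\<in>UNIV. cscale (v i k + w i k) (u i k))"
    by (simp add: cscale_add_left sum.distrib)
  then show ?thesis unfolding Salg_iff by (intro exI)
qed

lemma Salg_cscale: "x \<in> Salg V \<Longrightarrow> cscale c x \<in> Salg V"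
proof -
  assume "x \<in> Salg V"
  then obtain w where "x = (\<Sum>i\<in>UNIV. \<Sum>k\<in>UNIV. cscale (w i k) (u i k))"
    unfolding Salg_iff by blast
  then have "cscale c x = (\<Sum>i\<in>UNIV. \<Sum>k\<in>UNIV. cscale (c * w i k) (u i k))"
    by (simp add: cscale_sum)
  then show ?thesis unfolding Salg_iff by (intro exI)
qed

lemma Salg_zero: "0 \<in> Salg V"
  using Salg_cscale[OF one_Salg, of 0] by simp

lemma Salg_sum: "(\<And>i. i \<in> I \<Longrightarrow> f i \<in> Salg V) \<Longrightarrow> sum f I \<in> Salg V"
  by (induction I rule: infinite_finite_induct) (auto intro: Salg_add Salg_zero)

lemma subspace_Salg: "subspace (Salg V)"
  unfolding subspace_def by (auto intro: Salg_zero Salg_add Salg_cscale simp flip: cscale_of_real)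

lemma u_Salg: "u p q \<in> Salg V"
proof -
  have "u p q = (\<Sum>i\<in>UNIV. \<Sum>k\<in>UNIV. cscale (if k = q then if i = p then 1 else 0 else 0) (u i k))"
    by (simp add: if_distrib[of "\<lambda>c. cscale c _"] cong: if_cong)
  then show ?thesis unfolding Salg_iff by (intro exI)
qed

lemma Salg_induct [consumes 1, case_names add cscale u]:
  assumes x: "x \<in> Salg V"
    and add: "\<And>x y. P x \<Longrightarrow> P y \<Longrightarrow> P (x + y)"
    and cscale: "\<And>c x. P x \<Longrightarrow> P (cscale c x)"
    and u: "\<And>p q. P (u p q)"
  shows "P x"
proof -
  have P0: "P 0" using cscale[OF u, of 0] by simp
  have sumP: "P (sum f I)" if "\<And>i. P (f i)" for f :: "'n \<Rightarrow> 'n op1" and I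
    using that by (induction I rule: infinite_finite_induct) (auto intro: P0 add)
  obtain w where "x = (\<Sum>i\<in>UNIV. \<Sum>k\<in>UNIV. cscale (w i k) (u i k))"
    using x unfolding Salg_iff by blast
  then show ?thesis by (simp add: sumP cscale u)
qed

lemma coproduct_linear: "linear (coproduct V)"
  unfolding coproduct_def
  by (rule linearI) (simp_all add: linear_add[OF linear_tensor_one] linear_scale[OF linear_tensor_one]
      mult_linear_simps)

lemma coproduct_cscale: "coproduct V (cscale c x) = cscale c (coproduct V x)"
proof -
  have "tensor_op (cscale c x) (mat 1) = cscale c (tensor_op x (mat 1))"
    by (simp add: vec_eq_iff)
  then show ?thesis by (simp add: coproduct_def cscale_mult_left cscale_mult_right)
qed

lemma coproduct_mult: "coproduct V (x ** y) = coproduct V x ** coproduct V y"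
proof -
  have "tensor_op (x ** y) (mat 1) = tensor_op x (mat 1) ** tensor_op y (mat 1)"
    by (simp add: tensor_op_mult)
  then show ?thesis
    by (simp add: coproduct_def unitary_V_cancel flip: matrix_mul_assoc)
qed

lemma coproduct_madj: "coproduct V (madj x) = madj (coproduct V x)"
  by (simp add: coproduct_def madj_mult madj_tensor matrix_mul_assoc)

text \<open>The pentagon equation presents \<open>leg12 V ** leg13 V\<close> as a conjugate of
  \<open>leg12 V\<close> by \<open>leg23 V\<close>. Since \<open>leg23 V\<close> is block diagonal
  in the first leg, block \<open>(p, q)\<close> of that conjugate is the coproduct of
  \<open>u p q\<close>.\<close>

lemma coproduct_u: "coproduct V (u p q) = (\<Sum>r\<in>UNIV. tensor_op (u p r) (u r q))"
proof -
  have inv: "leg23 V ** leg23 (madj V) = mat 1"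
    by (simp add: unitary_V leg_one flip: leg_mult)
  have "leg23 V ** leg12 V ** leg23 (madj V) = leg12 V ** leg13 V ** (leg23 V ** leg23 (madj V))"
    by (simp add: pentagon matrix_mul_assoc)
  then have eq: "leg23 V ** leg12 V ** leg23 (madj V) = leg12 V ** leg13 V"
    by (simp add: inv)
  have 1: "block1 p s (leg23 V ** leg12 V) = V ** block1 p s (leg12 V)" for s
  proof -
    have "block1 p r (leg23 V) ** block1 r s (leg12 V) = (if r = p then V ** block1 p s (leg12 V) else 0)" for r
      by (simp add: block1_leg mult_linear_simps)
    then show ?thesis by (simp add: block1_mult)
  qed
  have 2: "block1 p q (Y ** leg23 (madj V)) = block1 p q Y ** madj V" for Y :: "'n op3"
  proof -
    have "block1 p r Y ** block1 r q (leg23 (madj V)) = (if r = q then block1 p q Y ** madj V else 0)" for r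
      by (simp add: block1_leg mult_linear_simps)
    then show ?thesis by (simp add: block1_mult)
  qed
  have "coproduct V (u p q) = block1 p q (leg23 V ** leg12 V ** leg23 (madj V))"
    by (simp add: 1 2 coproduct_def block1_leg)
  also have "\<dots> = (\<Sum>r\<in>UNIV. tensor_op (u p r) (u r q))"
    unfolding eq block1_mult block1_leg by (simp add: tensor_op_mult)
  finally show ?thesis .
qed

section \<open>Invariance of the trace under the coproduct\<close>

lemma trace_square: "(\<Sum>r\<in>UNIV. T p r * T r q) = of_nat CARD('n) * T p q"
proof -
  \<comment> \<open>The coproduct is a conjugation, so it keeps the trace of
    \<open>u p q \<otimes> 1\<close>; this is the origin of the factor
    \<open>CARD('n)\<close>.\<close>
  have "trace (coproduct V (u p q)) = trace (madj V ** (V ** tensor_op (u p q) (mat 1)))"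
    unfolding coproduct_def by (rule trace_mul_sym)
  also have "\<dots> = of_nat CARD('n) * T p q"
    by (simp add: unitary_V_cancel trace_tensor trace_I)
  finally have "trace (coproduct V (u p q)) = of_nat CARD('n) * T p q" .
  then show ?thesis by (simp add: coproduct_u trace_sum trace_tensor)
qed

text \<open>By \<open>trace_square\<close> the columns of \<open>T\<close> are eigenvectors of
  \<open>T\<close> for \<open>CARD('n)\<close>, as \<open>fixed_of_partial_trace\<close> requires.
  The sum is the coproduct of \<open>u p q\<close> with the trace applied to its second leg.\<close>

lemma trace_invariant_right: "(\<Sum>r\<in>UNIV. cscale (T r q) (u p r)) = cscale (T p q) (mat 1)"
proof -
  have "(\<Sum>r\<in>UNIV. V $ (p, j) $ (r, l) * (\<chi> r. T r q) $ r) = (if j = l then (\<chi> r. T r q) $ p else 0)" for j l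
    by (rule fixed_of_partial_trace) (use mult_unitary in \<open>simp_all add: multiplicative_unitary_def trace_square\<close>)
  then show ?thesis by (simp add: vec_eq_iff mat_def mult.commute)
qed

lemma trace_madj: "trace (madj A) = cnj (trace A)"
  by (simp add: trace_def)

text \<open>The same argument for \<open>madj V\<close>, whose partial trace is the adjoint of
  \<open>T\<close>: conjugated rows replace columns, and the trace is applied to the first
  leg.\<close>

lemma trace_invariant_left: "(\<Sum>r\<in>UNIV. cscale (T p r) (u r q)) = cscale (T p q) (mat 1)"
proof -
  have uni: "unitary (madj V)" by (simp add: unitary_def unitary_V)
  have sq: "(\<Sum>r\<in>UNIV. trace (block1 s r (madj V)) * (\<chi> r. cnj (T p r)) $ r) =
     of_nat CARD('n) * (\<chi> r. cnj (T p r)) $ s" for s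
    using arg_cong[OF trace_square[of p s], of cnj]
    by (simp add: block_madj trace_madj mult.commute)
  have "cnj (\<Sum>r\<in>UNIV. T p r * V $ (r, l) $ (q, j)) = cnj (if j = l then T p q else 0)" for j l
    using fixed_of_partial_trace[OF uni sq, of q j l] by (simp add: mult.commute)
  then have "(\<Sum>r\<in>UNIV. T p r * V $ (r, l) $ (q, j)) = (if j = l then T p q else 0)" for j l
    unfolding complex_cnj_cancel_iff .
  then show ?thesis by (auto simp: vec_eq_iff mat_def)
qed

section \<open>Products, adjoints and the counit of \<open>Salg V\<close>\<close>

lemma coproduct_nth:
  "coproduct V x $ (j, j') $ (l, l') = (\<Sum>c'\<in>UNIV. \<Sum>d\<in>UNIV. \<Sum>c\<in>UNIV.
     V $ (j, j') $ (c, d) * x $ c $ c' * cnj (V $ (l, l') $ (c', d)))"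
proof -
  have "(V ** tensor_op x (mat 1)) $ (j, j') $ (c', d) = (\<Sum>c\<in>UNIV. V $ (j, j') $ (c, d) * x $ c $ c')" for c' d
    by (simp add: matrix_matrix_mult_def sum_pair mat_def mult.assoc[symmetric]
        if_distrib[of "\<lambda>t. _ * t"] cong: if_cong)
  then show ?thesis
    by (simp add: coproduct_def matrix_matrix_mult_def[of "V ** _"] sum_pair sum_distrib_right)
qed

text \<open>In finite dimension an injective operator that maps a subspace into itself maps it onto
  itself, so its inverse preserves the subspace too.\<close>

lemma mem_of_left_invariant:
  fixes Z :: "('n op2) set"
  assumes Z: "subspace Z" and inv: "\<And>X. X \<in> Z \<Longrightarrow> V ** X \<in> Z" and Y: "Y \<in> Z"
  shows "madj V ** Y \<in> Z"
proof -
  have "inj_on (\<lambda>X. V ** X) Z" by (rule inj_on_inverseI) (rule unitary_V_cancel(1))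
  then have "(\<lambda>X. V ** X) ` Z = Z"
    using inv by (intro image_eq_of_inj_on[OF Z linear_mult_left]) auto
  then obtain X where "X \<in> Z" "Y = V ** X" using Y by blast
  then show ?thesis by (simp add: unitary_V_cancel)
qed

text \<open>This is the pentagon equation solved for \<open>leg13 V ** leg23 V\<close> and read in
  blocks over the first two legs, where \<open>leg12\<close> contributes only scalars.\<close>

lemma u_mult: "u i k ** u i' k' = (\<Sum>a\<in>UNIV. \<Sum>b\<in>UNIV. \<Sum>d\<in>UNIV.
    cscale (madj V $ (i, i') $ (a, b) * V $ (a, d) $ (k, k')) (u b d))"
proof -
  define blk :: "'n \<Rightarrow> 'n \<Rightarrow> 'n \<Rightarrow> 'n \<Rightarrow> 'n op3 \<Rightarrow> 'n op1" where
    "blk = (\<lambda>i i' k k' X. \<chi> j l. X $ (i, i', j) $ (k, k', l))"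
  have blk_mult: "blk i i' k k' (X ** Y) =
    (\<Sum>a\<in>UNIV. \<Sum>b\<in>UNIV. blk i i' a b X ** blk a b k k' Y)" for i i' k k' X Y
    by (simp add: blk_def vec_eq_iff matrix_matrix_mult_def sum_pair)
  have blk12: "blk i i' k k' (leg12 X) = cscale (X $ (i, i') $ (k, k')) (mat 1)" for i i' k k' X
    by (simp add: blk_def leg12_def vec_eq_iff mat_def)
  have blk13: "blk i i' k k' (leg13 V) = (if i' = k' then u i k else 0)" for i i' k k'
    by (simp add: blk_def leg13_def vec_eq_iff)
  have blk23: "blk i i' k k' (leg23 V) = (if i = k then u i' k' else 0)" for i i' k k'
    by (simp add: blk_def leg23_def vec_eq_iff)
  have "leg12 (madj V) ** leg12 V = mat 1"
    by (simp add: unitary_V leg_one flip: leg_mult)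
  moreover have "leg12 (madj V) ** (leg23 V ** leg12 V) = (leg12 (madj V) ** leg12 V) ** (leg13 V ** leg23 V)"
    by (simp add: pentagon[symmetric] matrix_mul_assoc)
  ultimately have eq: "leg12 (madj V) ** (leg23 V ** leg12 V) = leg13 V ** leg23 V" by simp
  have "blk i i' r r' (leg13 V) ** blk r r' k k' (leg23 V) =
      (if r' = i' then if r = k then u i k ** u i' k' else 0 else 0)" for r r'
    by (auto simp: blk13 blk23 mult_linear_simps)
  then have 1: "blk i i' k k' (leg13 V ** leg23 V) = u i k ** u i' k'"
    by (simp add: blk_mult)
  have "blk a b c d (leg23 V) ** blk c d k k' (leg12 V) =
      (if c = a then cscale (V $ (a, d) $ (k, k')) (u b d) else 0)" for a b c d
    by (simp add: blk12 blk23 mult_linear_simps cscale_mult_right)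
  then have "blk a b k k' (leg23 V ** leg12 V) = (\<Sum>d\<in>UNIV. cscale (V $ (a, d) $ (k, k')) (u b d))" for a b
    by (simp add: blk_mult) (subst sum.swap, simp)
  then have "blk i i' k k' (leg12 (madj V) ** (leg23 V ** leg12 V)) = (\<Sum>a\<in>UNIV. \<Sum>b\<in>UNIV. \<Sum>d\<in>UNIV.
    cscale (madj V $ (i, i') $ (a, b) * V $ (a, d) $ (k, k')) (u b d))"
    by (subst blk_mult) (simp add: blk12 cscale_mult_left cscale_sum)
  then show ?thesis by (simp add: eq 1)
qed

lemma Salg_mult:
  assumes "x \<in> Salg V" "y \<in> Salg V"
  shows "x ** y \<in> Salg V"
  using assms(1)
proof (induction rule: Salg_induct)
  case (add x x') then show ?case by (simp add: mult_linear_simps Salg_add)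
next
  case (cscale c x) then show ?case by (simp add: cscale_mult_left Salg_cscale)
next
  case (u p q)
  show ?case using assms(2)
  proof (induction rule: Salg_induct)
    case (add x x') then show ?case by (simp add: mult_linear_simps Salg_add)
  next
    case (cscale c x) then show ?case by (simp add: cscale_mult_right Salg_cscale)
  next
    case (u p' q')
    show ?case unfolding u_mult by (intro Salg_sum Salg_cscale u_Salg)
  qed
qed

text \<open>\<open>Z\<close> is \<open>L(H) \<otimes> S\<close>. It contains the unit and is stable
  under \<open>V\<close>, hence under \<open>madj V\<close>; so it contains \<open>madj V\<close>,
  whose blocks are the adjoints of the \<open>u p q\<close>.\<close>

lemma Salg_madj:
  assumes "x \<in> Salg V"
  shows "madj x \<in> Salg V"
proof -
  define Z :: "('n op2) set" where "Z = {X. \<forall>i k. block1 i k X \<in> Salg V}"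
  have "subspace Z"
    using subspace_Salg
    by (simp add: Z_def subspace_def linear_0[OF linear_block(1)] linear_add[OF linear_block(1)]
        linear_scale[OF linear_block(1)])
  then have "madj V ** mat 1 \<in> Z"
    by (rule mem_of_left_invariant)
      (auto simp: Z_def block1_mult block_one intro: Salg_sum Salg_mult u_Salg one_Salg Salg_zero)
  then have u: "madj (u p q) \<in> Salg V" for p q
    using block_madj(1)[of q p V] by (simp add: Z_def) metis
  show ?thesis using assms
    by (induction rule: Salg_induct) (auto simp: madj_add madj_cscale intro: Salg_add Salg_cscale u)
qed

text \<open>A functional \<open>w\<close> with \<open>(id \<otimes> w)(V) = 1\<close> is sought, so
  the unit must lie in the space \<open>range L\<close> of slices along the other leg. That space is
  closed under products, by comparing two formulas for the entries of the coproduct. Hence the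
  operators with blocks in \<open>range L\<close> are stable under \<open>V\<close>; they contain
  \<open>V\<close>, so also \<open>madj V ** V\<close>.\<close>

lemma ex_counit:
  "\<exists>w. \<forall>i k. (\<Sum>j\<in>UNIV. \<Sum>l\<in>UNIV. w $ j $ l * V $ (i, j) $ (k, l)) = (if i = k then 1 else (0 :: complex))"
proof -
  define L :: "'n op1 \<Rightarrow> 'n op1" where
    "L w = (\<Sum>j\<in>UNIV. \<Sum>l\<in>UNIV. cscale (w $ j $ l) (block2 j l V))" for w
  have linL: "linear L"
  proof -
    have "cscale (r *\<^sub>R c) A = r *\<^sub>R cscale c A" for r c and A :: "'n op1"
      by (simp add: vec_eq_iff)
    then show ?thesis
      unfolding L_def
      by (intro linearI) (simp_all add: cscale_add_left sum.distrib scaleR_sum_right)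
  qed
  have sub: "subspace (range L)" by (rule linear_subspace_image[OF linL subspace_UNIV])
  have Lc: "cscale c y \<in> range L" if y: "y \<in> range L" for c y
  proof -
    obtain w where "y = L w" using y by blast
    then have "cscale c y = L (cscale c w)" by (simp add: L_def cscale_sum)
    then show ?thesis by simp
  qed
  have block: "block2 j l V \<in> range L" for j l
  proof -
    have "L (\<chi> a b. if b = l then if a = j then 1 else 0 else 0) = block2 j l V"
      by (simp add: L_def if_distrib[of "\<lambda>c. cscale c _"] cong: if_cong)
    then show ?thesis by (metis rangeI)
  qed
  have "block2 j l V ** block2 j' l' V = (\<Sum>c'\<in>UNIV. \<Sum>d\<in>UNIV. \<Sum>c\<in>UNIV.
      cscale (V $ (j, j') $ (c, d) * cnj (V $ (l, l') $ (c', d))) (block2 c c' V))" for j l j' l'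
  proof -
    have "(block2 j l V ** block2 j' l' V) $ p $ q = coproduct V (u p q) $ (j, j') $ (l, l')" for p q
      by (simp add: coproduct_u matrix_matrix_mult_def)
    then show ?thesis by (simp add: coproduct_nth vec_eq_iff mult_ac)
  qed
  then have blocks: "block2 j l V ** block2 j' l' V \<in> range L" for j l j' l'
    by (simp add: subspace_sum[OF sub] Lc block)
  have mult: "block2 j l V ** y \<in> range L" if y: "y \<in> range L" for j l y
  proof -
    obtain w where "y = L w" using y by blast
    then have "block2 j l V ** y = (\<Sum>a\<in>UNIV. \<Sum>b\<in>UNIV. cscale (w $ a $ b) (block2 j l V ** block2 a b V))"
      by (simp add: L_def mult_linear_simps cscale_mult_right)
    also have "\<dots> \<in> range L" by (intro subspace_sum[OF sub] Lc blocks)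
    finally show ?thesis .
  qed
  define Z :: "('n op2) set" where "Z = {X. \<forall>j l. block2 j l X \<in> range L}"
  have "subspace Z"
    by (rule subspaceI)
      (simp_all add: Z_def linear_0[OF linear_block(2)] linear_add[OF linear_block(2)]
        linear_scale[OF linear_block(2)] subspace_0[OF sub] subspace_add[OF sub] subspace_scale[OF sub])
  then have "madj V ** V \<in> Z"
    by (rule mem_of_left_invariant)
      (auto simp: Z_def block2_mult block intro!: subspace_sum[OF sub] mult)
  \<comment> \<open>Any diagonal block of the unit will do; \<open>undefined\<close> merely names
    some index.\<close>
  then have "block2 undefined undefined (mat 1 :: 'n op2) \<in> range L" by (simp add: unitary_V Z_def)
  then obtain w where w: "mat 1 = L w" by (auto simp: block_one)
  have "(\<Sum>j\<in>UNIV. \<Sum>l\<in>UNIV. w $ j $ l * V $ (i, j) $ (k, l)) = (if i = k then 1 else 0)" for i k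
    using arg_cong[OF w, of "\<lambda>A. A $ i $ k"] by (simp add: L_def mat_def)
  then show ?thesis by blast
qed

definition counit :: "'n op1 \<Rightarrow> complex" where
  "counit x = (\<Sum>j\<in>UNIV. \<Sum>l\<in>UNIV. (SOME w. \<forall>i k.
     (\<Sum>j\<in>UNIV. \<Sum>l\<in>UNIV. w $ j $ l * V $ (i, j) $ (k, l)) = (if i = k then 1 else 0)) $ j $ l * x $ j $ l)"

lemma counit_u: "counit (u p q) = (if p = q then 1 else 0)"
  unfolding counit_def block_nth using someI_ex[OF ex_counit] by blast

lemma counit_add: "counit (x + y) = counit x + counit y"
  by (simp add: counit_def distrib_left sum.distrib)

lemma counit_cscale: "counit (cscale c x) = c * counit x"
  by (simp add: counit_def sum_distrib_left mult_ac)

lemma counit_sum: "counit (sum f I) = (\<Sum>i\<in>I. counit (f i))"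
proof -
  have "counit 0 = 0" by (simp add: counit_def)
  then show ?thesis
    by (induction I rule: infinite_finite_induct) (simp_all add: counit_add)
qed

lemma unitary_rows:
  "(\<Sum>q\<in>UNIV. \<Sum>i\<in>UNIV. V $ (t, k) $ (q, i) * cnj (V $ (r, j) $ (q, i))) = (if t = r \<and> k = j then 1 else 0)"
  using arg_cong[OF unitary_V(1), of "\<lambda>A. A $ (t, k) $ (r, j)"]
  by (simp add: matrix_matrix_mult_def sum_pair mat_def)

lemma unitary_cols:
  "(\<Sum>p\<in>UNIV. \<Sum>i\<in>UNIV. cnj (V $ (p, i) $ (t, k)) * V $ (p, i) $ (r, j)) = (if t = r \<and> k = j then 1 else 0)"
  using arg_cong[OF unitary_V(2), of "\<lambda>A. A $ (t, k) $ (r, j)"]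
  by (simp add: matrix_matrix_mult_def sum_pair mat_def)

text \<open>Applied to \<open>u_mult\<close>, the counit sets \<open>b = d\<close>, and what remains
  is an entry of \<open>madj V ** V\<close>.\<close>

lemma counit_u_mult: "counit (u i k ** u i' k') = counit (u i k) * counit (u i' k')"
proof -
  have "counit (u i k ** u i' k') = (\<Sum>a\<in>UNIV. \<Sum>b\<in>UNIV. cnj (V $ (a, b) $ (i, i')) * V $ (a, b) $ (k, k'))"
    unfolding u_mult counit_sum counit_cscale counit_u
    by (simp add: if_distrib[of "\<lambda>t. _ * t"] cong: if_cong)
  then show ?thesis by (simp add: unitary_cols counit_u)
qed

lemma counit_mult:
  assumes "x \<in> Salg V" "y \<in> Salg V"
  shows "counit (x ** y) = counit x * counit y"
  using assms(1)
proof (induction rule: Salg_induct)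
  case (add x x') then show ?case by (simp add: mult_linear_simps counit_add algebra_simps)
next
  case (cscale c x) then show ?case by (simp add: cscale_mult_left counit_cscale)
next
  case (u p q)
  show ?case using assms(2)
  proof (induction rule: Salg_induct)
    case (add x x') then show ?case by (simp add: mult_linear_simps counit_add algebra_simps)
  next
    case (cscale c x) then show ?case by (simp add: cscale_mult_right counit_cscale)
  next
    case (u p' q')
    show ?case by (rule counit_u_mult)
  qed
qed

lemma counit_one: "counit (mat 1) = 1"
proof -
  have "counit (u p p) * counit (mat 1) = counit (u p p)" for p
    using counit_mult[OF u_Salg one_Salg] by simp
  then show ?thesis by (simp add: counit_u)
qed

section \<open>The two ways of cutting the coproduct into blocks\<close>

lemma block_coproduct_u:
  "block1 k i (coproduct V (u p q)) = (\<Sum>r\<in>UNIV. cscale (V $ (p, k) $ (r, i)) (u r q))"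
  "block2 k i (coproduct V (u p q)) = (\<Sum>r\<in>UNIV. cscale (V $ (r, k) $ (q, i)) (u p r))"
  by (simp_all add: coproduct_u linear_sum[OF linear_block(1)] linear_sum[OF linear_block(2)] block_tensor)

lemma block_cscale:
  "block1 k i (cscale c X) = cscale c (block1 k i X)" "block2 k i (cscale c X) = cscale c (block2 k i X)"
  by (simp_all add: vec_eq_iff)

lemmas coproduct_simps =
  linear_add[OF coproduct_linear] coproduct_cscale block_cscale
  linear_add[OF linear_block(1)] linear_add[OF linear_block(2)]
  cscale_add_left cscale_add_right trace_add trace_cscale counit_add counit_cscale

lemma hopf_blocks_right: "hopf_blocks (Salg V) (\<lambda>k i x. block2 k i (coproduct V x)) counit"
proof (rule hopf_blocks.intro)
  fix k i
  show "linear (\<lambda>x. block2 k i (coproduct V x))"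
    using linear_compose[OF coproduct_linear linear_block(2)] by (simp add: o_def)
  show "block2 k i (coproduct V (x ** y)) =
    (\<Sum>l\<in>UNIV. block2 k l (coproduct V x) ** block2 l i (coproduct V y))" for x y
    by (simp add: coproduct_mult block2_mult)
  show "block2 k i (coproduct V x) \<in> Salg V" if "x \<in> Salg V" for x
    using that by (induction rule: Salg_induct)
      (auto simp: coproduct_simps block_coproduct_u intro!: Salg_add Salg_cscale Salg_sum u_Salg)
  show "trace (block2 k i (coproduct V x)) = (if k = i then trace x else 0)" if "x \<in> Salg V" for x
    using that
  proof (induction rule: Salg_induct)
    case (u p q)
    have "trace (block2 k i (coproduct V (u p q))) = (\<Sum>r\<in>UNIV. cscale (T p r) (u r q)) $ k $ i"
      by (simp add: block_coproduct_u trace_sum trace_cscale mult.commute)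
    then show ?case by (simp add: trace_invariant_left mat_def)
  qed (auto simp: coproduct_simps)
  show "counit (block2 k i (coproduct V x)) = x $ k $ i" if "x \<in> Salg V" for x
    using that
    by (induction rule: Salg_induct)
      (auto simp: coproduct_simps block_coproduct_u counit_sum counit_u
        if_distrib[of "\<lambda>t. _ * t"] cong: if_cong)
next
  show "(\<Sum>i\<in>UNIV. block2 i i (coproduct V x)) = cscale (trace x) (mat 1)" if "x \<in> Salg V" for x
    using that
  proof (induction rule: Salg_induct)
    case (u p q)
    have "(\<Sum>i\<in>UNIV. block2 i i (coproduct V (u p q))) =
      (\<Sum>r\<in>UNIV. \<Sum>i\<in>UNIV. cscale (V $ (r, i) $ (q, i)) (u p r))"
      unfolding block_coproduct_u by (rule sum.swap)
    also have "\<dots> = (\<Sum>r\<in>UNIV. cscale (T r q) (u p r))"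
      by (simp add: trace_def cscale_sum_left)
    finally show ?case by (simp add: trace_invariant_right)
  qed (simp_all add: coproduct_simps sum.distrib flip: cscale_sum)
  show "\<exists>g. (\<forall>i. g i \<in> Salg V) \<and>
    (\<forall>k. (\<Sum>i\<in>UNIV. block2 k i (coproduct V (g i))) = (if k = j then x else 0))"
    if "x \<in> Salg V" for j x
    using that
  proof (induction rule: Salg_induct)
    case (add x y)
    then obtain g h where gh: "\<forall>i. g i \<in> Salg V" "\<forall>i. h i \<in> Salg V"
      "\<forall>k. (\<Sum>i\<in>UNIV. block2 k i (coproduct V (g i))) = (if k = j then x else 0)"
      "\<forall>k. (\<Sum>i\<in>UNIV. block2 k i (coproduct V (h i))) = (if k = j then y else 0)" by blast
    then show ?case
      by (intro exI[of _ "\<lambda>i. g i + h i"]) (simp add: coproduct_simps sum.distrib Salg_add)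
  next
    case (cscale c x)
    then obtain g where "\<forall>i. g i \<in> Salg V"
      "\<forall>k. (\<Sum>i\<in>UNIV. block2 k i (coproduct V (g i))) = (if k = j then x else 0)" by blast
    then show ?case
      by (intro exI[of _ "\<lambda>i. cscale c (g i)"]) (simp add: coproduct_simps Salg_cscale flip: cscale_sum)
  next
    case (u p r)
    \<comment> \<open>The coefficients come from \<open>V ** madj V = mat 1\<close>: the blocks for
      \<open>u p q\<close> carry the entries \<open>V $ (t, k) $ (q, i)\<close>, and summing over
      the column pair \<open>(q, i)\<close> against a conjugated row leaves only
      \<open>t = r\<close> and \<open>k = j\<close>.\<close>
    define g where "g i = (\<Sum>q\<in>UNIV. cscale (cnj (V $ (r, j) $ (q, i))) (u p q))" for i
    have "(\<Sum>i\<in>UNIV. block2 k i (coproduct V (g i))) = (if k = j then u p r else 0)" for k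
    proof -
      have "(\<Sum>i\<in>UNIV. block2 k i (coproduct V (g i))) = (\<Sum>i\<in>UNIV. \<Sum>q\<in>UNIV. \<Sum>t\<in>UNIV.
          cscale (V $ (t, k) $ (q, i) * cnj (V $ (r, j) $ (q, i))) (u p t))"
        by (simp add: g_def linear_sum[OF coproduct_linear] linear_sum[OF linear_block(2)]
            coproduct_cscale block_cscale block_coproduct_u cscale_sum mult.commute)
      also have "\<dots> = (\<Sum>t\<in>UNIV. \<Sum>q\<in>UNIV. \<Sum>i\<in>UNIV.
          cscale (V $ (t, k) $ (q, i) * cnj (V $ (r, j) $ (q, i))) (u p t))"
        by (subst sum.swap, subst (2) sum.swap, subst sum.swap) (rule refl)
      also have "\<dots> = (\<Sum>t\<in>UNIV. cscale (if t = r \<and> k = j then 1 else 0) (u p t))"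
        unfolding unitary_rows[symmetric] cscale_sum_left ..
      also have "\<dots> = (\<Sum>t\<in>UNIV. if t = r then if k = j then u p r else 0 else 0)"
        by (rule sum.cong) auto
      finally show ?thesis by simp
    qed
    then show ?case
      by (intro exI[of _ g]) (auto simp: g_def intro!: Salg_sum Salg_cscale u_Salg)
  qed
qed (fact Salg_add Salg_cscale Salg_mult one_Salg counit_add counit_cscale counit_one counit_mult)+

lemma hopf_blocks_left: "hopf_blocks (Salg V) (\<lambda>k i x. block1 k i (coproduct V x)) counit"
proof (rule hopf_blocks.intro)
  fix k i
  show "linear (\<lambda>x. block1 k i (coproduct V x))"
    using linear_compose[OF coproduct_linear linear_block(1)] by (simp add: o_def)
  show "block1 k i (coproduct V (x ** y)) =
    (\<Sum>l\<in>UNIV. block1 k l (coproduct V x) ** block1 l i (coproduct V y))" for x y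
    by (simp add: coproduct_mult block1_mult)
  show "block1 k i (coproduct V x) \<in> Salg V" if "x \<in> Salg V" for x
    using that by (induction rule: Salg_induct)
      (auto simp: coproduct_simps block_coproduct_u intro!: Salg_add Salg_cscale Salg_sum u_Salg)
  show "trace (block1 k i (coproduct V x)) = (if k = i then trace x else 0)" if "x \<in> Salg V" for x
    using that
  proof (induction rule: Salg_induct)
    case (u p q)
    have "trace (block1 k i (coproduct V (u p q))) = (\<Sum>r\<in>UNIV. cscale (T r q) (u p r)) $ k $ i"
      by (simp add: block_coproduct_u trace_sum trace_cscale mult.commute)
    then show ?case by (simp add: trace_invariant_right mat_def)
  qed (auto simp: coproduct_simps)
  show "counit (block1 k i (coproduct V x)) = x $ k $ i" if "x \<in> Salg V" for x
    using that
    by (induction rule: Salg_induct)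
      (auto simp: coproduct_simps block_coproduct_u counit_sum counit_u
        if_distrib[of "\<lambda>t. _ * t"] cong: if_cong)
next
  show "(\<Sum>i\<in>UNIV. block1 i i (coproduct V x)) = cscale (trace x) (mat 1)" if "x \<in> Salg V" for x
    using that
  proof (induction rule: Salg_induct)
    case (u p q)
    have "(\<Sum>i\<in>UNIV. block1 i i (coproduct V (u p q))) =
      (\<Sum>r\<in>UNIV. \<Sum>i\<in>UNIV. cscale (V $ (p, i) $ (r, i)) (u r q))"
      unfolding block_coproduct_u by (rule sum.swap)
    also have "\<dots> = (\<Sum>r\<in>UNIV. cscale (T p r) (u r q))"
      by (simp add: trace_def cscale_sum_left)
    finally show ?case by (simp add: trace_invariant_left)
  qed (simp_all add: coproduct_simps sum.distrib flip: cscale_sum)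
  \<comment> \<open>For \<open>block1\<close> of the coproduct of \<open>u p q\<close> the summed
    indices would be \<open>p\<close> from a row and \<open>i\<close> from a column of
    \<open>V\<close>, where unitarity does not apply directly. Taking adjoints swaps the block
    indices and makes \<open>(p, i)\<close> a row pair; hence the detour through
    \<open>madj x\<close>.\<close>
  have ex: "\<exists>g. (\<forall>i. g i \<in> Salg V) \<and>
    (\<forall>k. (\<Sum>i\<in>UNIV. block1 k i (coproduct V (g i))) = (if k = j then madj x else 0))"
    if "x \<in> Salg V" for j x
    using that
  proof (induction rule: Salg_induct)
    case (add x y)
    then obtain g h where gh: "\<forall>i. g i \<in> Salg V" "\<forall>i. h i \<in> Salg V"
      "\<forall>k. (\<Sum>i\<in>UNIV. block1 k i (coproduct V (g i))) = (if k = j then madj x else 0)"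
      "\<forall>k. (\<Sum>i\<in>UNIV. block1 k i (coproduct V (h i))) = (if k = j then madj y else 0)" by blast
    then show ?case
      by (intro exI[of _ "\<lambda>i. g i + h i"]) (simp add: coproduct_simps sum.distrib Salg_add madj_add)
  next
    case (cscale c x)
    then obtain g where "\<forall>i. g i \<in> Salg V"
      "\<forall>k. (\<Sum>i\<in>UNIV. block1 k i (coproduct V (g i))) = (if k = j then madj x else 0)" by blast
    then show ?case
      by (intro exI[of _ "\<lambda>i. cscale (cnj c) (g i)"])
        (simp add: coproduct_simps Salg_cscale madj_cscale flip: cscale_sum)
  next
    case (u t q)
    define g where "g i = (\<Sum>p\<in>UNIV. cscale (V $ (p, i) $ (t, j)) (madj (u p q)))" for i
    have "(\<Sum>i\<in>UNIV. block1 k i (coproduct V (g i))) = (if k = j then madj (u t q) else 0)" for k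
    proof -
      have "(\<Sum>i\<in>UNIV. block1 k i (coproduct V (g i))) = (\<Sum>i\<in>UNIV. \<Sum>p\<in>UNIV. \<Sum>r\<in>UNIV.
          cscale (cnj (V $ (p, i) $ (r, k)) * V $ (p, i) $ (t, j)) (madj (u r q)))"
        by (simp add: g_def linear_sum[OF coproduct_linear] linear_sum[OF linear_block(1)] coproduct_madj
            block_madj coproduct_cscale block_cscale block_coproduct_u cscale_sum madj_sum madj_cscale
            mult.commute)
      also have "\<dots> = (\<Sum>r\<in>UNIV. \<Sum>p\<in>UNIV. \<Sum>i\<in>UNIV.
          cscale (cnj (V $ (p, i) $ (r, k)) * V $ (p, i) $ (t, j)) (madj (u r q)))"
        by (subst sum.swap, subst (2) sum.swap, subst sum.swap) (rule refl)
      also have "\<dots> = (\<Sum>r\<in>UNIV. cscale (if r = t \<and> k = j then 1 else 0) (madj (u r q)))"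
        unfolding unitary_cols[symmetric] cscale_sum_left ..
      also have "\<dots> = (\<Sum>r\<in>UNIV. if r = t then if k = j then madj (u t q) else 0 else 0)"
        by (rule sum.cong) auto
      finally show ?thesis by simp
    qed
    then show ?case
      by (intro exI[of _ g]) (auto simp: g_def intro!: Salg_sum Salg_cscale Salg_madj u_Salg)
  qed
  show "\<exists>g. (\<forall>i. g i \<in> Salg V) \<and>
    (\<forall>k. (\<Sum>i\<in>UNIV. block1 k i (coproduct V (g i))) = (if k = j then x else 0))"
    if "x \<in> Salg V" for j x
    using ex[OF Salg_madj[OF that], of j] by (simp only: madj_madj)
qed (fact Salg_add Salg_cscale Salg_mult one_Salg counit_add counit_cscale counit_one counit_mult)+

lemma coideal_axioms_of_subalgebra:
  assumes B: "unital_subalgebra B (Salg V)" and h: "hopf_blocks (Salg V) D counit"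
    and D: "\<And>k i x. x \<in> B \<Longrightarrow> D k i x \<in> B"
  shows "coideal (Salg V) D counit B"
proof -
  interpret hopf_blocks "Salg V" D counit by (rule h)
  show ?thesis
    by standard (use B D in \<open>auto simp: unital_subalgebra_def\<close>)
qed

text \<open>Slicing the \<open>S\<close> factor of the coproduct leaves values in \<open>B\<close>.
  The side of the coideal decides only between \<open>block1\<close> and \<open>block2\<close>, not
  the side of the module.\<close>

lemma free_left_module_of_coideal:
  assumes "left_coideal_subalgebra V B \<or> right_coideal_subalgebra V B"
  shows "free_left_module B (Salg V)"
proof -
  have B: "unital_subalgebra B (Salg V)"
    using assms by (auto simp: left_coideal_subalgebra_def right_coideal_subalgebra_def)
  then have closed: "cscale c x \<in> B" "x \<in> B \<Longrightarrow> y \<in> B \<Longrightarrow> x + y \<in> B" "mat 1 \<in> B" if "x \<in> B" for c x y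
    using that by (auto simp: unital_subalgebra_def)
  have "0 \<in> B" using closed(1)[of "mat 1" 0] B by (simp add: unital_subalgebra_def)
  then have sums: "(\<Sum>t<m. cscale (c t) (f t)) \<in> B" if "\<forall>t<m. f t \<in> B" for m :: nat and c f
    using that by (induction m) (auto intro: closed)
  from assms show ?thesis
  proof
    assume L: "left_coideal_subalgebra V B"
    have "block1 k i (coproduct V x) \<in> B" if "x \<in> B" for k i x
    proof -
      have "coproduct V x \<in> alg_tensor (Salg V) B"
        using L that by (simp add: left_coideal_subalgebra_def)
      then obtain m f g where "\<forall>t<(m::nat). g t \<in> B" "coproduct V x = (\<Sum>t<m. tensor_op (f t) (g t))"
        by (auto simp: alg_tensor_def)
      then show ?thesis
        by (simp add: linear_sum[OF linear_block(1)] block_tensor sums)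
    qed
    then interpret coideal "Salg V" "\<lambda>k i x. block1 k i (coproduct V x)" counit B
      by (rule coideal_axioms_of_subalgebra[OF B hopf_blocks_left])
    show ?thesis by (rule free_left_module_S)
  next
    assume R: "right_coideal_subalgebra V B"
    have "block2 k i (coproduct V x) \<in> B" if "x \<in> B" for k i x
    proof -
      have "coproduct V x \<in> alg_tensor B (Salg V)"
        using R that by (simp add: right_coideal_subalgebra_def)
      then obtain m f g where "\<forall>t<(m::nat). f t \<in> B" "coproduct V x = (\<Sum>t<m. tensor_op (f t) (g t))"
        by (auto simp: alg_tensor_def)
      then show ?thesis
        by (simp add: linear_sum[OF linear_block(2)] block_tensor sums)
    qed
    then interpret coideal "Salg V" "\<lambda>k i x. block2 k i (coproduct V x)" counit B
      by (rule coideal_axioms_of_subalgebra[OF B hopf_blocks_right])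
    show ?thesis by (rule free_left_module_S)
  qed
qed

lemma alg_tensor_madj:
  assumes "Z \<in> alg_tensor X Y"
  shows "madj Z \<in> alg_tensor (madj ` X) (madj ` Y)"
proof -
  obtain m f g where Z: "\<forall>t<(m::nat). f t \<in> X \<and> g t \<in> Y" "Z = (\<Sum>t<m. tensor_op (f t) (g t))"
    using assms by (auto simp: alg_tensor_def)
  then have "madj Z = (\<Sum>t<m. tensor_op (madj (f t)) (madj (g t)))"
    by (simp add: madj_sum madj_tensor)
  moreover have "\<forall>t<m. madj (f t) \<in> madj ` X \<and> madj (g t) \<in> madj ` Y" using Z(1) by blast
  ultimately show ?thesis
    unfolding alg_tensor_def mem_Collect_eq
    by (rule_tac exI[of _ m], rule_tac exI[of _ "\<lambda>t. madj (f t)"],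
        rule_tac exI[of _ "\<lambda>t. madj (g t)"], intro conjI)
qed

lemma madj_image_Salg: "madj ` Salg V = Salg V"
proof -
  have "x \<in> madj ` Salg V" if "x \<in> Salg V" for x
    using imageI[OF Salg_madj[OF that], of madj] by simp
  then show ?thesis using Salg_madj by auto
qed

lemma unital_subalgebra_madj:
  assumes B: "unital_subalgebra B (Salg V)"
  shows "unital_subalgebra (madj ` B) (Salg V)"
  unfolding unital_subalgebra_def
proof (intro conjI ballI allI impI)
  show "madj ` B \<subseteq> Salg V" using B Salg_madj by (auto simp: unital_subalgebra_def)
  show "mat 1 \<in> madj ` B" using B by (metis imageI madj_one unital_subalgebra_def)
next
  fix x y assume "x \<in> madj ` B" "y \<in> madj ` B"
  then obtain a b where ab: "a \<in> B" "b \<in> B" "x = madj a" "y = madj b" by blast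
  have "x + y = madj (a + b)" "x ** y = madj (b ** a)" by (simp_all add: ab madj_add madj_mult)
  then show "x + y \<in> madj ` B" "x ** y \<in> madj ` B"
    using B ab by (simp_all add: unital_subalgebra_def)
next
  fix c x assume "x \<in> madj ` B"
  then obtain a where a: "a \<in> B" "x = madj a" by blast
  have "cscale c x = madj (cscale (cnj c) a)" by (simp add: a madj_cscale)
  then show "cscale c x \<in> madj ` B" using B a by (simp add: unital_subalgebra_def)
qed

text \<open>The coproduct commutes with adjoints and \<open>Salg V\<close> is stable under them, so
  the legs keep their places although products are reversed.\<close>

lemma coideal_subalgebra_madj:
  "left_coideal_subalgebra V B \<Longrightarrow> left_coideal_subalgebra V (madj ` B)"
  "right_coideal_subalgebra V B \<Longrightarrow> right_coideal_subalgebra V (madj ` B)"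
  unfolding left_coideal_subalgebra_def right_coideal_subalgebra_def
  by (auto simp: unital_subalgebra_madj coproduct_madj,
      metis alg_tensor_madj madj_image_Salg, metis alg_tensor_madj madj_image_Salg)

end

theorem theorem4p9:
  fixes V :: "complex^('n::finite\<times>'n)^('n\<times>'n)"
    and B :: "(complex^'n^'n) set"
  assumes "multiplicative_unitary V"
    and "multiplicity_one V"
    and "left_coideal_subalgebra V B \<or> right_coideal_subalgebra V B"
  shows "free_left_module B (Salg V) \<and> free_right_module B (Salg V)"
proof -
  interpret mult_unitary V
    using assms(1,3)
    by unfold_locales
      (auto simp: left_coideal_subalgebra_def right_coideal_subalgebra_def unital_subalgebra_def)
  have "free_left_module B (Salg V)"
    by (rule free_left_module_of_coideal[OF assms(3)])
  moreover have "free_right_module B (Salg V)"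
    by (rule free_right_module_of_adjoint[OF free_left_module_of_coideal Salg_madj])
      (use assms(3) coideal_subalgebra_madj in blast)
  ultimately show ?thesis ..
qed

end
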